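(* Let $\gamma=[1^{a_1},\dots,n^{a_n}]\vdash n$ have at least two parts, and let $i$ be such that $a_i>0$. Then for every $m\ge1$, $$\widetilde{\mu}_{n,m}(\gamma)=-\sum_{l>m}\widetilde{S}_{m,1}(l)\,\widetilde{\mu}_{n,l}(\gamma)+\frac{1}{i\,a_i}\sum_{l>0}\widetilde{S}_{m,i}(l)\,\widetilde{\mu}_{n-i,l}\big(\gamma^{\downarrow(i)}\big).$$
   Context: For $N\ge1$, fix $\omega=(1\,2\,\cdots\,N)$; for $\gamma\vdash N$ and $m\ge1$, $\mu_{N,m}(\gamma)$ is the number of pairs $(\sigma,\pi)$ of permutations of $[N]$ with $\sigma\pi=\omega$, $\sigma$ of cycle type $\gamma$, and $\pi$ having exactly $m$ cycles (so $\mu_{N,m}(\gamma)=0$ for $m>N$). Set $\widetilde{\mu}_{N,m}(\gamma)=\frac{m!}{N!}\mu_{N,m}(\gamma)$. For integers $m,i\ge1$ and $l\ge1$, $\widetilde{S}_{m,i}(l)=\sum_{j=1}^{i}\binom{i}{j}\frac{(m+j-i)!\,S(l,m+j-i)}{l!}$, where $S(l,r)$ is the Stirling number of the second kind, with the convention that a term is $0$ when $m+j-i<0$ or $m+j-i>l$ (and $S(l,0)=0$ for $l\ge1$). $[1^{a_1},\dots,n^{a_n}]$ denotes the partition with $a_k$ parts equal to $k$, and for $a_i>0$, $\gamma^{\downarrow(i)}=[1^{a_1},\dots,(i-1)^{a_{i-1}},i^{a_i-1},(i+1)^{a_{i+1}},\dots,n^{a_n}]\vdash n-i$ is $\gamma$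 with one part equal to $i$ removed. *)

theory Defs
  imports "HOL-Combinatorics.Combinatorics" "HOL-Library.Multiset" Complex_Main
begin

definition long_cycle :: "nat \<Rightarrow> nat \<Rightarrow> nat" where
  "long_cycle N x = (if 1 \<le> x \<and> x < N then x + 1 else if x = N then 1 else x)"

definition cycles_of :: "nat \<Rightarrow> (nat \<Rightarrow> nat) \<Rightarrow> nat set set" where
  "cycles_of N p = (\<lambda>x. orbit p x) ` {1..N}"

definition cycle_type :: "nat \<Rightarrow> (nat \<Rightarrow> nat) \<Rightarrow> nat multiset" where
  "cycle_type N p = image_mset card (mset_set (cycles_of N p))"

definition num_cycles :: "nat \<Rightarrow> (nat \<Rightarrow> nat) \<Rightarrow> nat" where
  "num_cycles N p = card (cycles_of N p)"

definition is_partition :: "nat multiset \<Rightarrow> nat \<Rightarrow> bool" where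
  "is_partition \<gamma> n \<longleftrightarrow> (\<forall>k \<in># \<gamma>. 0 < k) \<and> sum_mset \<gamma> = n"

definition mu :: "nat \<Rightarrow> nat \<Rightarrow> nat multiset \<Rightarrow> nat" where
  "mu N m \<gamma> = card {(\<sigma>, \<pi>). \<sigma> permutes {1..N} \<and> \<pi> permutes {1..N} \<and>
       \<sigma> \<circ> \<pi> = long_cycle N \<and> cycle_type N \<sigma> = \<gamma> \<and> num_cycles N \<pi> = m}"

definition mu_tilde :: "nat \<Rightarrow> nat \<Rightarrow> nat multiset \<Rightarrow> real" where
  "mu_tilde N m \<gamma> = fact m / fact N * real (mu N m \<gamma>)"

definition S_tilde :: "nat \<Rightarrow> nat \<Rightarrow> nat \<Rightarrow> real" where
  "S_tilde m i l = (\<Sum>j = 1..i. real (i choose j) *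
     (let r = int m + int j - int i in
      if r < 0 \<or> r > int l then 0
      else fact (nat r) * real (Stirling l (nat r)) / fact l))"

end

theory Submission
  imports Defs "HOL-Computational_Algebra.Polynomial"
begin

text \<open>
  For fixed $\sigma$ on a set of size $N$, sum $\sum_m m!\, S(c(\pi), m)\, y^m$ over all $\pi$ such that
  $\sigma\pi$ is an $N$-cycle, where $c(\pi)$ is the number of cycles of $\pi$; the coefficient of $y^m$
  counts the surjective colourings of the cycles of $\pi$ with $m$ colours. The result is
  $(N-1)!\; y \prod_k ((1+y)^k - y^k)$, the product being over the cycle lengths $k$ of $\sigma$.
  Deleting one point $z$ from $\sigma$, $\pi$ and $\sigma\pi$ shows this by induction: if $z$ is not fixed
  by $\sigma$, then what remains is either one colouring operator applied to the polynomial of the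
  contracted $\sigma'$, or a sum over $\sigma'$ times a transposition, whose cycles are cut or joined.

  Since all $N$-cycles are conjugate, the polynomial attached to $\gamma$ is therefore the size of its
  conjugacy class times $y \prod_k ((1+y)^k - y^k)$. Removing a part $i$ divides this by
  $(1+y)^i - y^i = \sum_{j=1}^{i} \binom{i}{j} y^{i-j}$ up to the quotient of the class sizes, and comparing
  coefficients gives the recurrence.
\<close>

section \<open>Orbits under multiplication by a transposition\<close>

text \<open>Computes an orbit from a closed walk \<open>g\<close>; the cut lemma lists both of its
  pieces this way.\<close>

lemma orbit_eq_enum:
  assumes "0 < l" and step: "\<And>i. i < l \<Longrightarrow> f (g i) = g (Suc i)" and "g l = g 0"
  shows "orbit f (g 0) = g ` {..<l}"
proof -
  have *: "(f ^^ i) (g 0) = g i" if "i \<le> l" for i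
    using that by (induction i) (auto simp: step)
  have "orbit f (g 0) = {(f ^^ i) (g 0) |i. i < l}"
    by (rule orbit_altdef_bounded) (use * assms in auto)
  also have "\<dots> = (\<lambda>i. (f ^^ i) (g 0)) ` {..<l}"
    by auto
  also have "\<dots> = g ` {..<l}"
    by (rule image_cong) (simp_all add: *)
  finally show ?thesis .
qed

lemma orbit_funpow_enum:
  fixes a :: 'a
  assumes "permutation p"
  defines "k \<equiv> card (orbit p a)"
  shows "orbit p a = (\<lambda>i. (p ^^ i) a) ` {..<k}" "inj_on (\<lambda>i. (p ^^ i) a) {..<k}"
    "(p ^^ k) a = a" "0 < k"
proof -
  have a: "a \<in> orbit p a"
    using assms(1) by (rule permutation_self_in_orbit)
  have k: "k = funpow_dist1 p a a"
    using orbit_conv_funpow_dist1[OF a] inj_on_funpow_dist1[OF a]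
    by (simp add: k_def card_image)
  show "orbit p a = (\<lambda>i. (p ^^ i) a) ` {..<k}" "inj_on (\<lambda>i. (p ^^ i) a) {..<k}"
    using orbit_conv_funpow_dist1[OF a] inj_on_funpow_dist1[OF a]
    unfolding k by (auto simp: atLeast0LessThan)
  show "(p ^^ k) a = a" "0 < k"
    unfolding k using funpow_dist1_prop[OF a] by auto
qed

lemma permutation_orbit_eq:
  assumes "permutation p" "y \<in> orbit p x"
  shows "orbit p y = orbit p x"
  using assms cyclic_on_orbit' orbit_cyclic_eq3 by metis

text \<open>Composing with the transposition exchanges the images of \<open>a\<close> and
  \<open>b\<close>: from \<open>a\<close> the walk continues at \<open>p b\<close>, runs through the
  cycle of \<open>b\<close> until it reaches \<open>b\<close>, continues at \<open>p a\<close> and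
  closes up through the cycle of \<open>a\<close>.\<close>

lemma orbit_comp_transpose_join:
  assumes p: "permutation p" and b: "b \<notin> orbit p a"
  shows "orbit (p \<circ> transpose a b) a = orbit p a \<union> orbit p b"
proof -
  let ?q = "p \<circ> transpose a b" and ?O = "orbit (p \<circ> transpose a b) a"
  have self: "x \<in> orbit p x" for x
    using p by (rule permutation_self_in_orbit)
  have a: "a \<notin> orbit p b"
    using b permutation_orbit_eq[OF p] self by metis
  have ob: "y \<in> ?O" if "y \<in> orbit p b" for y
    using that
  proof induction
    case base
    have "p b = ?q a" by simp
    then show ?case by (simp only: orbit.base)
  next
    case (step y)
    show ?case
    proof (cases "y = b")
      case True
      have "p b = ?q a" by simp
      then show ?thesis using True by (simp only: orbit.base)
    next
      case False
      moreover have "y \<noteq> a" using step a by auto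
      ultimately have "p y = ?q y" by simp
      then show ?thesis using step by (simp only: orbit.step)
    qed
  qed
  \<comment> \<open>\<open>b\<close> has been reached from \<open>a\<close>, and its new image is
    \<open>p a\<close>.\<close>
  then have pa: "p a \<in> ?O"
    using orbit.step[of b ?q a] self by simp
  have oa: "y \<in> ?O" if "y \<in> orbit p a" for y
    using that
  proof induction
    case base
    then show ?case by (fact pa)
  next
    case (step y)
    show ?case
    proof (cases "y = a")
      case False
      moreover have "y \<noteq> b" using step b by auto
      ultimately have "p y = ?q y" by simp
      then show ?thesis using step by (simp only: orbit.step)
    qed (use pa in \<open>simp only:\<close>)
  qed
  have "y \<in> orbit p a \<union> orbit p b" if "y \<in> ?O" for y
    using that
  proof induction
    case base
    then show ?case by (simp add: orbit.base)
  next
    case (step y)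
    then show ?case
      by (cases "y = a"; cases "y = b") (auto intro: orbit.intros)
  qed
  then show ?thesis using oa ob by blast
qed

lemma orbit_comp_transpose_other:
  assumes "permutation p" "c \<notin> orbit p a" "c \<notin> orbit p b"
  shows "orbit (p \<circ> transpose a b) c = orbit p c"
proof (rule orbit_cong)
  show "c \<in> orbit p c"
    using assms(1) by (rule permutation_self_in_orbit)
  fix s assume s: "s \<in> orbit p c"
  have "s \<noteq> a" "s \<noteq> b"
    using s assms permutation_orbit_eq[OF assms(1)] permutation_self_in_orbit[OF assms(1)] by metis+
  then show "(p \<circ> transpose a b) s = p s" by simp
qed

text \<open>Write x_i = p^i e and let k be the length of the cycle. Exchanging the images of x_s and
  x_0 = e splits the cycle into (e, x_{s+1}, ..., x_{k-1}) and (x_s, x_1, ..., x_{s-1}).\<close>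

lemma orbit_comp_transpose_cut:
  fixes e :: 'a
  assumes p: "permutation p" and s: "0 < s" "s < card (orbit p e)"
  defines "q \<equiv> p \<circ> transpose ((p ^^ s) e) e"
  shows "(p ^^ s) e \<notin> orbit q e" "card (orbit q e) = card (orbit p e) - s"
    "card (orbit q ((p ^^ s) e)) = s"
proof -
  define k where "k = card (orbit p e)"
  define x where "x i = (p ^^ i) e" for i
  have inj: "inj_on x {..<k}" and xk: "x k = e" and x0: "x 0 = e" and k: "0 < k"
    using orbit_funpow_enum[OF p, of e] unfolding k_def x_def by auto
  have step: "p (x i) = x (Suc i)" for i
    by (simp add: x_def)
  have sk: "s < k" using s by (simp add: k_def)
  have q: "q (x i) = x (Suc i)" if "0 < i" "i < k" "i \<noteq> s" for i
  proof -
    have "x i \<noteq> x 0" "x i \<noteq> x s"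
      using that sk k inj_onD[OF inj, of i 0] inj_onD[OF inj, of i s] by auto
    then show "q (x i) = x (Suc i)"
      using x0 step by (simp add: q_def x_def[symmetric])
  qed
  have qs: "q (x s) = p e" "q e = x (Suc s)" using step[of s] by (auto simp: q_def x_def)
  \<comment> \<open>\<open>g\<close> and \<open>h\<close> walk through the two pieces; they close up
    because \<open>x k = e\<close> and \<open>h s = x s = h 0\<close>.\<close>
  define g where "g i = (if i = 0 then e else x (s + i))" for i
  define h where "h i = (if i = 0 then x s else x i)" for i
  have "orbit q (g 0) = g ` {..<k - s}"
    by (rule orbit_eq_enum) (use sk s qs q xk in \<open>auto simp: g_def\<close>)
  moreover have "g ` {..<k - s} = insert e (x ` {s<..<k})"
  proof -
    have "{..<k - s} = insert 0 {0<..<k - s}" using sk by auto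
    moreover have "g ` {0<..<k - s} = x ` {s<..<k}"
    proof -
      have "(\<lambda>i. s + i) ` {0<..<k - s} = {s<..<k}"
        by (auto simp: image_iff Bex_def) presburger
      then have "x ` {s<..<k} = (\<lambda>i. x (s + i)) ` {0<..<k - s}"
        by (metis image_image)
      also have "\<dots> = g ` {0<..<k - s}" by (rule image_cong) (auto simp: g_def)
      finally show ?thesis by simp
    qed
    moreover have "g 0 = e" by (simp add: g_def)
    ultimately show ?thesis by (simp only: image_insert)
  qed
  ultimately have oe: "orbit q e = x ` insert 0 {s<..<k}" by (simp add: g_def x0)
  have "orbit q (h 0) = h ` {..<s}"
    by (rule orbit_eq_enum) (use sk s qs q x0 step[of 0] in \<open>auto simp: h_def\<close>)
  moreover have "h ` {..<s} = insert (x s) (x ` {0<..<s})"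
  proof -
    have "{..<s} = insert 0 {0<..<s}" using s by auto
    moreover have "h ` {0<..<s} = x ` {0<..<s}" by (rule image_cong) (auto simp: h_def)
    moreover have "h 0 = x s" by (simp add: h_def)
    ultimately show ?thesis by (simp only: image_insert)
  qed
  ultimately have os: "orbit q (x s) = x ` insert s {0<..<s}" by (simp add: h_def)
  have sub: "insert 0 {s<..<k} \<subseteq> {..<k}" "insert s {0<..<s} \<subseteq> {..<k}" using sk by auto
  show "(p ^^ s) e \<notin> orbit q e"
    unfolding oe x_def[symmetric] using inj_on_image_mem_iff[OF inj _ sub(1), of s] sk s by simp
  show "card (orbit q e) = card (orbit p e) - s"
    unfolding oe k_def[symmetric] using card_image[OF inj_on_subset[OF inj sub(1)]] sk
    by (simp add: card_insert_if)
  show "card (orbit q ((p ^^ s) e)) = s"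
    unfolding x_def[symmetric] os using card_image[OF inj_on_subset[OF inj sub(2)]] s
    by (simp add: card_insert_if)
qed

section \<open>Effect of a transposition on the set of all orbits\<close>

lemma orbits_join:
  assumes A: "finite A" and p: "p permutes A" and ab: "a \<in> A" "b \<in> A" "b \<notin> orbit p a"
  shows "orbit (p \<circ> transpose a b) ` A
    = insert (orbit p a \<union> orbit p b) (orbit p ` A - {orbit p a, orbit p b})"
proof -
  let ?q = "p \<circ> transpose a b"
  have perm: "permutation p" using A p by (auto simp: permutation_permutes)
  have "?q permutes A" using p ab by (intro permutes_compose permutes_swap_id)
  then have permq: "permutation ?q" using A by (auto simp: permutation_permutes)
  note self = permutation_self_in_orbit[OF perm]
  note eq = permutation_orbit_eq[OF perm]
  have j: "orbit ?q c = orbit p a \<union> orbit p b" if "c \<in> orbit p a \<union> orbit p b" for c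
    using orbit_comp_transpose_join[OF perm ab(3)] permutation_orbit_eq[OF permq] that by metis
  have o: "orbit ?q c = orbit p c" if "c \<notin> orbit p a \<union> orbit p b" for c
    using orbit_comp_transpose_other[OF perm] that by blast
  have "orbit p c = orbit p a \<or> orbit p c = orbit p b \<longleftrightarrow> c \<in> orbit p a \<union> orbit p b" for c
    using self eq by (metis Un_iff)
  then have "orbit p ` A - {orbit p a, orbit p b} = orbit p ` (A - (orbit p a \<union> orbit p b))"
    by auto
  moreover have "orbit ?q ` (A - (orbit p a \<union> orbit p b)) = orbit p ` (A - (orbit p a \<union> orbit p b))"
    by (rule image_cong) (use o in auto)
  moreover have "orbit ?q ` (A \<inter> (orbit p a \<union> orbit p b)) = {orbit p a \<union> orbit p b}"
    using j ab(1) self by (auto 0 3 simp: image_iff)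
  moreover have "A = (A \<inter> (orbit p a \<union> orbit p b)) \<union> (A - (orbit p a \<union> orbit p b))" by auto
  ultimately show ?thesis by (metis image_Un insert_is_Un)
qed

lemma orbits_insert_fixed:
  assumes "p permutes A" "z \<notin> A"
  shows "orbit p ` insert z A = insert {z} (orbit p ` A)"
  using assms orbit_eq_singleton_iff[of p z] by (auto simp: permutes_def)

text \<open>Conjugating \<open>transpose z e\<close> by \<open>p\<close>, which fixes
  \<open>z\<close>, gives \<open>transpose z (p e)\<close>. This trades the left factors in the
  enumeration of permutations of \<open>insert z A\<close> for the right factors in the orbit
  lemmas.\<close>

lemma transpose_comp_eq_comp_transpose:
  assumes "p permutes A" "z \<notin> A"
  shows "transpose z (p e) \<circ> p = p \<circ> transpose z e"
proof
  fix x
  have "p z = z" using assms by (rule permutes_not_in)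
  then show "(transpose z (p e) \<circ> p) x = (p \<circ> transpose z e) x"
    using inj_eq[OF permutes_inj[OF assms(1)], of x] by (simp add: transpose_def) metis
qed

text \<open>The left transposition inserts \<open>z\<close> directly before \<open>w\<close> in its
  cycle. Moved to the right of \<open>p\<close>, it joins the singleton cycle of \<open>z\<close> to
  the cycle of the preimage \<open>e\<close> of \<open>w\<close>, so \<open>orbits_join\<close>
  applies.\<close>

lemma orbits_insert_join:
  assumes A: "finite A" and p: "p permutes A" and z: "z \<notin> A" and w: "w \<in> A"
  shows "orbit (transpose z w \<circ> p) ` insert z A = insert (insert z (orbit p w)) (orbit p ` A - {orbit p w})"
proof -
  obtain e where e: "w = p e" "e \<in> A"
    using p w by (metis permutes_image image_iff)
  have perm: "permutation p" using A p by (auto simp: permutation_permutes)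
  have oz: "orbit p z = {z}" using p z by (auto simp: orbit_eq_singleton_iff permutes_not_in)
  have ow: "orbit p w = orbit p e" unfolding e by (rule permutation_orbit_step[OF perm])
  have p': "p permutes insert z A" using p by (rule permutes_subset) auto
  have sub: "orbit p e \<subseteq> A" using permutes_orbit_subset[OF p e(2)] .
  have "orbit (p \<circ> transpose z e) ` insert z A
      = insert (orbit p z \<union> orbit p e) (orbit p ` insert z A - {orbit p z, orbit p e})"
    by (rule orbits_join) (use A p' oz e z in auto)
  also have "\<dots> = insert (insert z (orbit p e)) (orbit p ` A - {orbit p e})"
    using orbits_insert_fixed[OF p z] permutes_orbit_subset[OF p] z oz by auto
  finally show ?thesis
    using transpose_comp_eq_comp_transpose[OF p z, of e] e ow by simp
qed

section \<open>Polynomial identities\<close>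

abbreviation y_poly :: "real poly" where "y_poly \<equiv> [:0, 1:]"

definition cycle_poly :: "nat \<Rightarrow> real poly" where
  "cycle_poly k = [:1, 1:] ^ k - y_poly ^ k"

lemma cycle_poly_1 [simp]: "cycle_poly (Suc 0) = 1"
  by (simp add: cycle_poly_def one_pCons)

text \<open>As A - B = 1, the differences A^k - B^k form the Lucas sequence with parameters A + B
  and AB, and this is its addition formula.\<close>

lemma diff_pow_mult_pow:
  fixes A B :: "'a::comm_ring_1"
  assumes "A = 1 + B" "0 < g"
  shows "(A ^ (p + g) - B ^ (p + g)) =
    (A ^ (p + 1) - B ^ (p + 1)) * (A ^ g - B ^ g) - A * B * (A ^ p - B ^ p) * (A ^ (g - 1) - B ^ (g - 1))"
proof (cases g)
  case (Suc h)
  show ?thesis unfolding assms(1) Suc by (simp add: power_add algebra_simps)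
qed (use assms in simp)

lemma cycle_poly_add:
  "0 < g \<Longrightarrow> cycle_poly (p + g) = cycle_poly (p + 1) * cycle_poly g - [:1, 1:] * y_poly * cycle_poly p * cycle_poly (g - 1)"
  unfolding cycle_poly_def by (rule diff_pow_mult_pow) (simp add: one_pCons)

text \<open>Expanding each product leaves A^p + B^p and two mixed terms whose sums are geometric.
  The right-hand side is arranged so that its last two terms cancel against \<open>color_op\<close>
  later.\<close>

lemma sum_diff_pow_mult:
  fixes A B :: "'a::comm_ring_1"
  assumes "A = 1 + B"
  shows "(\<Sum>s\<in>{0<..<p}. (A ^ s - B ^ s) * (A ^ (p - s) - B ^ (p - s)))
    = of_nat p * (A ^ (p + 1) - B ^ (p + 1)) - (A + B) * (A ^ p - B ^ p)
      - of_nat p * A * B * (A ^ (p - 1) - B ^ (p - 1))"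
proof (cases p)
  case (Suc q)
  have sum: "(\<Sum>s\<in>{0<..<p}. A ^ s * B ^ (p - s)) = A * B * (A ^ q - B ^ q)"
  proof -
    have "(\<Sum>s\<in>{0<..<p}. A ^ s * B ^ (p - s)) = (\<Sum>s<q. A ^ (Suc s) * B ^ (p - Suc s))"
      by (rule sum.reindex_bij_witness[of _ Suc "\<lambda>s. s - 1"]) (auto simp: Suc)
    also have "\<dots> = A * B * (\<Sum>s<q. A ^ s * B ^ (q - Suc s))"
      unfolding sum_distrib_left by (rule sum.cong) (auto simp: Suc Suc_diff_Suc[symmetric])
    \<comment> \<open>Inserting the factor A - B = 1 turns the geometric sum into the factorisation
      of A^q - B^q.\<close>
    also have "(\<Sum>s<q. A ^ s * B ^ (q - Suc s)) = (A - B) * (\<Sum>s<q. A ^ s * B ^ (q - Suc s))"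
      using assms by simp
    also have "\<dots> = A ^ q - B ^ q"
      by (simp add: power_diff_sumr2 mult.commute)
    finally show ?thesis .
  qed
  have sum': "(\<Sum>s\<in>{0<..<p}. A ^ (p - s) * B ^ s) = A * B * (A ^ q - B ^ q)"
    unfolding sum[symmetric]
    by (rule sum.reindex_bij_witness[of _ "\<lambda>s. p - s" "\<lambda>s. p - s"]) auto
  have "(\<Sum>s\<in>{0<..<p}. (A ^ s - B ^ s) * (A ^ (p - s) - B ^ (p - s)))
    = (\<Sum>s\<in>{0<..<p}. (A ^ p + B ^ p) - A ^ s * B ^ (p - s) - A ^ (p - s) * B ^ s)"
    by (rule sum.cong) (auto simp: algebra_simps power_add[symmetric])
  also have "\<dots> = of_nat q * (A ^ p + B ^ p) - 2 * (A * B * (A ^ q - B ^ q))"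
    by (simp add: sum_subtractf sum sum') (simp add: Suc algebra_simps)
  also have "\<dots> = of_nat p * (A ^ (p + 1) - B ^ (p + 1)) - (A + B) * (A ^ p - B ^ p)
      - of_nat p * A * B * (A ^ q - B ^ q)"
    unfolding assms Suc by (simp add: algebra_simps)
  finally show ?thesis by (simp add: Suc)
qed simp

lemma sum_cycle_poly_mult:
  "(\<Sum>s\<in>{0<..<p}. cycle_poly s * cycle_poly (p - s))
    = of_nat p * cycle_poly (p + 1) - ([:1, 1:] + y_poly) * cycle_poly p
      - of_nat p * [:1, 1:] * y_poly * cycle_poly (p - 1)"
  unfolding cycle_poly_def by (rule sum_diff_pow_mult) (simp add: one_pCons)

lemma pderiv_cycle_poly: "pderiv (cycle_poly k) = of_nat k * cycle_poly (k - 1)"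
proof -
  have "pderiv [:1, 1:] = (1 :: real poly)" "pderiv y_poly = 1"
    by (simp_all add: pderiv_pCons one_pCons)
  then show ?thesis
    by (simp only: cycle_poly_def pderiv_diff pderiv_power mult_1_right of_nat_poly
        smult_diff_right mult_smult_left mult_1_left)
      (simp add: smult_diff_right)
qed

text \<open>Coefficients are taken with respect to the basis of binomial coefficients
  $\binom{x}{m}$; in this encoding, \<open>color_op\<close> is multiplication by $x$, and
  \<open>color_poly l\<close> is $x^l$.\<close>

definition color_op :: "real poly \<Rightarrow> real poly" where
  "color_op f = y_poly * pderiv ([:1, 1:] * f)"

definition color_poly :: "nat \<Rightarrow> real poly" where
  "color_poly l = (color_op ^^ l) 1"

lemma color_poly_Suc [simp]: "color_poly (Suc l) = color_op (color_poly l)"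
  by (simp add: color_poly_def)

lemma color_op_add: "color_op (f + g) = color_op f + color_op g"
  by (simp only: color_op_def distrib_left pderiv_add)

lemma color_op_0: "color_op 0 = 0"
  by (simp add: color_op_def)

lemma color_op_sum: "color_op (\<Sum>x\<in>X. f x) = (\<Sum>x\<in>X. color_op (f x))"
  by (induction X rule: infinite_finite_induct)
    (simp_all add: color_op_add color_op_0)

lemma color_op_mult_of_nat: "color_op (of_nat c * f) = of_nat c * color_op f"
proof -
  have "[:1, 1:] * (of_nat c * f) = smult (of_nat c) ([:1, 1:] * f)"
    by (simp only: of_nat_poly mult_smult_right mult_smult_left smult_pCons[symmetric]) simp
  then show ?thesis
    unfolding color_op_def by (simp only: pderiv_smult of_nat_poly) simp
qed

text \<open>The coefficient of y^m in \<open>color_op f\<close> is m (f_m + f_{m-1}); for f_m = m!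
  S(l,m) this is the Stirling recurrence multiplied by m!.\<close>

lemma coeff_color_poly: "coeff (color_poly l) m = fact m * real (Stirling l m)"
proof (induction l arbitrary: m)
  case 0
  then show ?case by (cases m) (simp_all add: color_poly_def)
next
  case (Suc l)
  then show ?case
    by (cases m) (simp_all add: color_op_def coeff_pCons coeff_pderiv algebra_simps split: nat.splits)
qed

section \<open>Cutting and joining cycles\<close>

lemma permutes_permutation: "finite A \<Longrightarrow> p permutes A \<Longrightarrow> permutation p"
  by (auto simp: permutation_permutes)

text \<open>Makes the orbit created by a join a new element of the set of orbits, so that a product
  over that set splits off its factor.\<close>

lemma orbit_Un_notin:
  assumes "permutation p" "b \<notin> orbit p a"
  shows "orbit p a \<union> orbit p b \<notin> orbit p ` A"
proof
  assume "orbit p a \<union> orbit p b \<in> orbit p ` A"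
  then obtain c where c: "orbit p a \<union> orbit p b = orbit p c" by auto
  moreover have "a \<in> orbit p a" "b \<in> orbit p b"
    using permutation_self_in_orbit[OF assms(1)] by auto
  ultimately have "a \<in> orbit p c" "b \<in> orbit p c" by blast+
  then have "b \<in> orbit p a"
    using permutation_orbit_eq[OF assms(1), of a c] by simp
  then show False using assms(2) by simp
qed

text \<open>Reduces being a long cycle to the number of orbits, whose behaviour under insertion of a
  point is easy to follow.\<close>

lemma cyclic_on_iff_card_orbits:
  assumes "finite A" "p permutes A" "A \<noteq> {}"
  shows "cyclic_on p A \<longleftrightarrow> card (orbit p ` A) = 1"
proof
  assume "cyclic_on p A"
  then have "orbit p ` A = {A}" using assms(3) by (auto simp: cyclic_on_alldef)
  then show "card (orbit p ` A) = 1" by simp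
next
  assume "card (orbit p ` A) = 1"
  then obtain X where X: "orbit p ` A = {X}" by (rule card_1_singletonE)
  have "orbit p x = A" if "x \<in> A" for x
  proof
    show "orbit p x \<subseteq> A" using permutes_orbit_subset[OF assms(2) that] .
    show "A \<subseteq> orbit p x"
    proof
      fix y assume "y \<in> A"
      then have "orbit p y = orbit p x" using X that by (metis imageI singletonD)
      then show "y \<in> orbit p x"
        using permutation_self_in_orbit[OF permutes_permutation[OF assms(1,2)], of y] by simp
    qed
  qed
  then show "cyclic_on p A" using assms(3) by (auto simp: cyclic_on_def)
qed

lemma card_orbits_insert_join:
  assumes "finite A" "p permutes A" "z \<notin> A" "w \<in> A"
  shows "card (orbit (transpose z w \<circ> p) ` insert z A) = card (orbit p ` A)"
proof -
  have "insert z (orbit p w) \<notin> orbit p ` A - {orbit p w}"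
    using permutes_orbit_subset[OF assms(2)] assms(3) by auto
  then show ?thesis
    unfolding orbits_insert_join[OF assms]
    using assms card.remove[of "orbit p ` A" "orbit p w"] by simp
qed

lemma card_orbits_insert_fixed:
  assumes "finite A" "p permutes A" "z \<notin> A"
  shows "card (orbit p ` insert z A) = Suc (card (orbit p ` A))"
proof -
  have "{z} \<notin> orbit p ` A"
    using permutes_orbit_subset[OF assms(2)] assms(3) by auto
  then show ?thesis
    unfolding orbits_insert_fixed[OF assms(2,3)] using assms(1) by simp
qed

lemma cyclic_on_insert_join:
  assumes "finite A" "p permutes A" "z \<notin> A" "w \<in> A"
  shows "cyclic_on (transpose z w \<circ> p) (insert z A) \<longleftrightarrow> cyclic_on p A"
proof -
  have "transpose z w \<circ> p permutes insert z A"
    using assms by (intro permutes_compose permutes_swap_id permutes_subset[OF assms(2)]) auto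
  then show ?thesis
    using assms cyclic_on_iff_card_orbits[of "insert z A"] cyclic_on_iff_card_orbits[of A]
      card_orbits_insert_join[OF assms] by auto
qed

lemma not_cyclic_on_insert_fixed:
  assumes "p permutes A" "z \<notin> A" "A \<noteq> {}"
  shows "\<not> cyclic_on p (insert z A)"
proof
  assume "cyclic_on p (insert z A)"
  then have "orbit p z = insert z A" by (auto simp: cyclic_on_alldef)
  moreover have "orbit p z = {z}"
    using assms by (auto simp: orbit_eq_singleton_iff permutes_not_in)
  ultimately show False using assms by auto
qed

text \<open>The product is indexed by the orbits themselves and not by their sizes, so cycles of
  equal length contribute separately.\<close>

definition orbit_prod :: "(nat \<Rightarrow> 'b::comm_semiring_1) \<Rightarrow> 'a set \<Rightarrow> ('a \<Rightarrow> 'a) \<Rightarrow> 'b" where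
  "orbit_prod w A p = (\<Prod>X\<in>orbit p ` A. w (card X))"

text \<open>Cut and join: a point \<open>b\<close> in the cycle of \<open>e\<close> cuts it into
  lengths s and k - s, with each s occurring for exactly one \<open>b\<close>; a point in another
  cycle \<open>X\<close> joins \<open>X\<close> to it, and all points of \<open>X\<close> give the
  same lengths.\<close>

lemma sum_orbit_prod_comp_transpose:
  fixes w :: "nat \<Rightarrow> 'b::comm_semiring_1"
  assumes A: "finite A" and p: "p permutes A" and e: "e \<in> A"
  defines "S \<equiv> orbit p ` A - {orbit p e}" and "k \<equiv> card (orbit p e)"
  shows "(\<Sum>b\<in>A - {e}. orbit_prod w A (p \<circ> transpose b e)) =
    (\<Sum>s\<in>{0<..<k}. w s * w (k - s)) * (\<Prod>X\<in>S. w (card X)) +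
    (\<Sum>X\<in>S. of_nat (card X) * (w (k + card X) * (\<Prod>X'\<in>S - {X}. w (card X'))))"
proof -
  note perm = permutes_permutation[OF A p]
  note self = permutation_self_in_orbit[OF perm]
  note eq = permutation_orbit_eq[OF perm]
  note sub = permutes_orbit_subset[OF p]
  have eqX: "X = orbit p y" if "X \<in> orbit p ` A" "y \<in> X" for X y
    using that eq by auto
  have finS: "finite S" using A by (simp add: S_def)
  have cut: "orbit_prod w A (p \<circ> transpose ((p ^^ s) e) e) = w s * w (k - s) * (\<Prod>X\<in>S. w (card X))"
    if s: "s \<in> {0<..<k}" for s
  proof -
    define a q where "a = (p ^^ s) e" and "q = p \<circ> transpose a e"
    have ae: "a \<in> orbit p e" unfolding a_def by (rule funpow_in_orbit) (rule self)
    then have aA: "a \<in> A" using sub e by auto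
    have q: "q permutes A" unfolding q_def using p aA e by (intro permutes_compose permutes_swap_id)
    note permq = permutes_permutation[OF A q]
    have cards: "a \<notin> orbit q e" "card (orbit q e) = k - s" "card (orbit q a) = s"
      using orbit_comp_transpose_cut[OF perm, of s e] s unfolding a_def q_def k_def by auto
    then have ea: "e \<notin> orbit q a"
      using permutation_orbit_eq[OF permq] permutation_self_in_orbit[OF permq] by metis
    \<comment> \<open>The cut is read backwards: multiplying \<open>q\<close> by the same
      transposition restores \<open>p\<close>, so the join lemmas for \<open>q\<close> describe
      it.\<close>
    have pq: "q \<circ> transpose a e = p" by (simp add: q_def comp_assoc)
    have Un: "orbit q a \<union> orbit q e = orbit p e"
      using orbit_comp_transpose_join[OF permq ea] eq[OF ae] by (simp add: pq)
    have "orbit p ` A = insert (orbit p e) (orbit q ` A - {orbit q a, orbit q e})"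
      using orbits_join[OF A q aA e ea] by (simp add: pq Un)
    moreover have "orbit p e \<notin> orbit q ` A"
      using orbit_Un_notin[OF permq ea] Un by simp
    ultimately have S: "S = orbit q ` A - {orbit q a, orbit q e}"
      by (auto simp: S_def)
    have "orbit q ` A = insert (orbit q a) (insert (orbit q e) S)"
      using aA e by (auto simp: S)
    moreover have "orbit q a \<noteq> orbit q e"
      using cards(1) permutation_self_in_orbit[OF permq] by metis
    moreover have "orbit q a \<notin> S" "orbit q e \<notin> S" by (auto simp: S)
    ultimately show ?thesis
      unfolding orbit_prod_def a_def[symmetric] q_def[symmetric] using finS cards
      by (simp add: mult.assoc)
  qed
  have join: "orbit_prod w A (p \<circ> transpose b e) = w (k + card X) * (\<Prod>X'\<in>S - {X}. w (card X'))"
    if X: "X \<in> S" and b: "b \<in> X" for X b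
  proof -
    obtain c where c: "X = orbit p c" "c \<in> A" using X by (auto simp: S_def)
    have Ob: "X = orbit p b" using eq b c by simp
    have bA: "b \<in> A" using sub c b by auto
    have eb: "e \<notin> orbit p b" using X eq Ob by (auto simp: S_def)
    have disj: "orbit p b \<inter> orbit p e = {}" using eq eb self by blast
    have fin: "finite (orbit p b)" "finite (orbit p e)" using self by (auto intro: finite_orbit)
    have "orbit p b \<union> orbit p e \<notin> orbit p ` A" by (rule orbit_Un_notin[OF perm eb])
    then have "orbit_prod w A (p \<circ> transpose b e) =
        w (card (orbit p b \<union> orbit p e)) * (\<Prod>X'\<in>orbit p ` A - {orbit p b, orbit p e}. w (card X'))"
      unfolding orbit_prod_def orbits_join[OF A p bA e eb] using A by simp
    also have "card (orbit p b \<union> orbit p e) = k + card X"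
      using disj fin by (simp add: card_Un_disjoint Ob k_def)
    also have "orbit p ` A - {orbit p b, orbit p e} = S - {X}"
      by (auto simp: S_def Ob)
    finally show ?thesis .
  qed
  have split: "A - {e} = (orbit p e - {e}) \<union> \<Union>S"
  proof
    show "A - {e} \<subseteq> (orbit p e - {e}) \<union> \<Union>S"
      using self by (auto simp: S_def)
    show "(orbit p e - {e}) \<union> \<Union>S \<subseteq> A - {e}"
      using sub e eq by (auto simp: S_def)
  qed
  have disj: "(orbit p e - {e}) \<inter> \<Union>S = {}"
  proof -
    have False if "x \<in> orbit p e" "x \<in> X" "X \<in> S" for x X
      using eqX[of X x] eq[OF that(1)] that by (simp add: S_def)
    then show ?thesis by blast
  qed
  have finO: "finite X" if "X \<in> S" for X
    using that self by (auto simp: S_def intro: finite_orbit)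
  have pw: "X \<inter> X' = {}" if "X \<in> S" "X' \<in> S" "X \<noteq> X'" for X X'
  proof -
    have False if "x \<in> X" "x \<in> X'" for x
      using eqX[of X x] eqX[of X' x] that \<open>X \<in> S\<close> \<open>X' \<in> S\<close> \<open>X \<noteq> X'\<close> by (simp add: S_def)
    then show ?thesis by blast
  qed
  note en = orbit_funpow_enum[OF perm, of e, folded k_def]
  let ?f = "\<lambda>b. orbit_prod w A (p \<circ> transpose b e)"
  \<comment> \<open>Exponent 0 gives \<open>e\<close> itself, so the other points of its cycle
    correspond to the exponents 1, ..., k - 1.\<close>
  have "(\<lambda>s. (p ^^ s) e) ` ({..<k} - {0}) = (\<lambda>s. (p ^^ s) e) ` {..<k} - (\<lambda>s. (p ^^ s) e) ` {0}"
    by (rule inj_on_image_set_diff[OF en(2)]) (use en(4) in auto)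
  moreover have "{..<k} - {0} = {0<..<k}" by auto
  ultimately have "orbit p e - {e} = (\<lambda>s. (p ^^ s) e) ` {0<..<k}"
    using en(1) by simp
  moreover have "inj_on (\<lambda>s. (p ^^ s) e) {0<..<k}"
    using en(2) by (rule inj_on_subset) auto
  ultimately have "sum ?f (orbit p e - {e}) = (\<Sum>s\<in>{0<..<k}. ?f ((p ^^ s) e))"
    by (simp add: sum.reindex)
  also have "\<dots> = (\<Sum>s\<in>{0<..<k}. w s * w (k - s)) * (\<Prod>X\<in>S. w (card X))"
    unfolding sum_distrib_right by (rule sum.cong) (use cut in auto)
  finally have 1: "sum ?f (orbit p e - {e}) = \<dots>" .
  have "sum ?f (\<Union>S) = (\<Sum>X\<in>S. sum ?f X)"
    using sum.Union_disjoint[of S ?f] finO pw by simp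
  also have "\<dots> = (\<Sum>X\<in>S. of_nat (card X) * (w (k + card X) * (\<Prod>X'\<in>S - {X}. w (card X'))))"
    by (rule sum.cong) (use join in auto)
  finally have 2: "sum ?f (\<Union>S) = \<dots>" .
  have "finite (orbit p e)" "finite (\<Union>S)"
    using finite_orbit[OF self] finS finO by auto
  then have "sum ?f (A - {e}) = sum ?f (orbit p e - {e}) + sum ?f (\<Union>S)"
    unfolding split by (intro sum.union_disjoint) (use disj in auto)
  then show ?thesis unfolding 1 2 .
qed

text \<open>Points are grouped by their orbit. The constant 1 gives the sum of the cycle lengths, an
  indicator counts the points in cycles of a given length.\<close>

lemma sum_card_orbits:
  assumes A: "finite A" and p: "p permutes A"
  shows "(\<Sum>b\<in>A. f (card (orbit p b))) = (\<Sum>X\<in>orbit p ` A. of_nat (card X) * (f (card X) :: 'b::semiring_1))"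
proof -
  note perm = permutes_permutation[OF A p]
  note self = permutation_self_in_orbit[OF perm]
  note eq = permutation_orbit_eq[OF perm]
  have "(\<Sum>b\<in>A. f (card (orbit p b))) = (\<Sum>X\<in>orbit p ` A. \<Sum>b\<in>{b\<in>A. orbit p b = X}. f (card (orbit p b)))"
    using A by (rule sum.image_gen)
  also have "\<dots> = (\<Sum>X\<in>orbit p ` A. of_nat (card X) * f (card X))"
  proof (rule sum.cong)
    fix X assume "X \<in> orbit p ` A"
    then obtain a where a: "a \<in> A" "X = orbit p a" by auto
    have X: "{b\<in>A. orbit p b = X} = X"
    proof
      show "{b\<in>A. orbit p b = X} \<subseteq> X" using self by auto
      show "X \<subseteq> {b\<in>A. orbit p b = X}"
        using permutes_orbit_subset[OF p a(1)] eq unfolding a(2) by blast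
    qed
    have "(\<Sum>b\<in>{b\<in>A. orbit p b = X}. f (card (orbit p b))) = (\<Sum>b\<in>{b\<in>A. orbit p b = X}. f (card X))"
      by (rule sum.cong) auto
    also have "\<dots> = of_nat (card X) * f (card X)"
      unfolding X by (rule sum_constant)
    finally show "(\<Sum>b\<in>{b\<in>A. orbit p b = X}. f (card (orbit p b))) = of_nat (card X) * f (card X)" .
  qed simp
  finally show ?thesis .
qed

section \<open>The generating polynomial of a fixed permutation\<close>

text \<open>The product ranges over all long cycles on \<open>A\<close> instead of a fixed one,
  which makes the family stable under deleting a point.\<close>

definition colored_sum :: "'a set \<Rightarrow> ('a \<Rightarrow> 'a) \<Rightarrow> real poly" where
  "colored_sum A \<sigma> = (\<Sum>\<pi> | \<pi> permutes A.
     if cyclic_on (\<sigma> \<circ> \<pi>) A then color_poly (card (orbit \<pi> ` A)) else 0)"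

text \<open>Each permutation of \<open>insert z A\<close> is
  \<open>transpose z b \<circ> \<pi>\<close> for unique \<open>b\<close> and \<open>\<pi>\<close>.
  For \<open>b = z\<close> the product fixes \<open>z\<close> and is no long cycle. For the
  \<open>card A\<close> other choices, \<open>z\<close> is merely inserted into one cycle of \<pi>
  and one of the product.\<close>

lemma colored_sum_insert_fixed:
  assumes A: "finite A" "A \<noteq> {}" and z: "z \<notin> A" and \<sigma>: "\<sigma> permutes A"
  shows "colored_sum (insert z A) \<sigma> = of_nat (card A) * colored_sum A \<sigma>"
proof -
  let ?g = "\<lambda>\<pi>. if cyclic_on (\<sigma> \<circ> \<pi>) (insert z A) then color_poly (card (orbit \<pi> ` insert z A)) else 0"
  have "colored_sum (insert z A) \<sigma> = (\<Sum>b\<in>insert z A. \<Sum>\<pi> | \<pi> permutes A. ?g (transpose z b \<circ> \<pi>))"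
    unfolding colored_sum_def by (rule sum_over_permutations_insert) (use A z in auto)
  also have "\<dots> = (\<Sum>\<pi> | \<pi> permutes A. ?g \<pi>) + (\<Sum>b\<in>A. \<Sum>\<pi> | \<pi> permutes A. ?g (transpose z b \<circ> \<pi>))"
    using A z by (simp cong: if_cong)
  also have "(\<Sum>\<pi> | \<pi> permutes A. ?g \<pi>) = 0"
  proof (rule sum.neutral, rule ballI)
    fix \<pi> assume "\<pi> \<in> {\<pi>. \<pi> permutes A}"
    then have "\<pi> permutes A" by simp
    then show "?g \<pi> = 0"
      using not_cyclic_on_insert_fixed[OF permutes_compose[OF _ \<sigma>] z A(2)] by (simp only: if_False)
  qed
  also have "(\<Sum>b\<in>A. \<Sum>\<pi> | \<pi> permutes A. ?g (transpose z b \<circ> \<pi>)) = (\<Sum>b\<in>A. colored_sum A \<sigma>)"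
  proof (rule sum.cong)
    fix b assume b: "b \<in> A"
    show "(\<Sum>\<pi> | \<pi> permutes A. ?g (transpose z b \<circ> \<pi>)) = colored_sum A \<sigma>"
      unfolding colored_sum_def
    proof (rule sum.cong)
      fix \<pi> assume "\<pi> \<in> {\<pi>. \<pi> permutes A}"
      then have \<pi>: "\<pi> permutes A" by simp
      have "\<sigma> \<circ> (transpose z b \<circ> \<pi>) = transpose z (\<sigma> b) \<circ> (\<sigma> \<circ> \<pi>)"
        using transpose_comp_eq_comp_transpose[OF \<sigma> z, of b] by (simp add: comp_assoc[symmetric])
      moreover have "\<sigma> b \<in> A" using b \<sigma> by (simp add: permutes_in_image)
      ultimately show "?g (transpose z b \<circ> \<pi>)
          = (if cyclic_on (\<sigma> \<circ> \<pi>) A then color_poly (card (orbit \<pi> ` A)) else 0)"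
        using cyclic_on_insert_join[OF A(1) permutes_compose[OF \<pi> \<sigma>] z]
          card_orbits_insert_join[OF A(1) \<pi> z b] by (simp only:)
    qed simp
  qed simp
  finally show ?thesis by simp
qed

text \<open>In the same decomposition, \<open>b = z\<close> gives \<pi> the extra cycle {z}, hence
  \<open>color_op\<close>; \<open>b = e\<close> cancels the transposition, so the product fixes
  \<open>z\<close> and contributes nothing; any other \<open>b\<close> leaves a transposition of
  \<open>b\<close> and \<open>e\<close> on \<sigma>.\<close>

lemma colored_sum_insert_join:
  assumes A: "finite A" and z: "z \<notin> A" and \<sigma>: "\<sigma> permutes A" and e: "e \<in> A"
  shows "colored_sum (insert z A) (\<sigma> \<circ> transpose z e)
    = color_op (colored_sum A \<sigma>) + (\<Sum>b\<in>A - {e}. colored_sum A (\<sigma> \<circ> transpose b e))"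
proof -
  let ?g = "\<lambda>\<pi>. if cyclic_on (\<sigma> \<circ> transpose z e \<circ> \<pi>) (insert z A)
    then color_poly (card (orbit \<pi> ` insert z A)) else 0"
  have ze: "z \<noteq> e" using z e by auto
  have ne: "A \<noteq> {}" using e by auto
  have "colored_sum (insert z A) (\<sigma> \<circ> transpose z e)
      = (\<Sum>b\<in>insert z A. \<Sum>\<pi> | \<pi> permutes A. ?g (transpose z b \<circ> \<pi>))"
    unfolding colored_sum_def by (rule sum_over_permutations_insert) (use A z in auto)
  also have "\<dots> = (\<Sum>\<pi> | \<pi> permutes A. ?g \<pi>) + ((\<Sum>\<pi> | \<pi> permutes A. ?g (transpose z e \<circ> \<pi>)) +
      (\<Sum>b\<in>A - {e}. \<Sum>\<pi> | \<pi> permutes A. ?g (transpose z b \<circ> \<pi>)))"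
    using A z by (simp add: sum.remove[OF A e] cong: if_cong)
  also have "(\<Sum>\<pi> | \<pi> permutes A. ?g \<pi>) = color_op (colored_sum A \<sigma>)"
    unfolding colored_sum_def color_op_sum
  proof (rule sum.cong)
    fix \<pi> assume "\<pi> \<in> {\<pi>. \<pi> permutes A}"
    then have \<pi>: "\<pi> permutes A" by simp
    have "\<sigma> \<circ> transpose z e \<circ> \<pi> = transpose z (\<sigma> e) \<circ> (\<sigma> \<circ> \<pi>)"
      using transpose_comp_eq_comp_transpose[OF \<sigma> z, of e] by (simp add: comp_assoc[symmetric])
    moreover have "\<sigma> e \<in> A" using e \<sigma> by (simp add: permutes_in_image)
    ultimately have "?g \<pi> = (if cyclic_on (\<sigma> \<circ> \<pi>) A then color_poly (Suc (card (orbit \<pi> ` A))) else 0)"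
      using cyclic_on_insert_join[OF A permutes_compose[OF \<pi> \<sigma>] z]
        card_orbits_insert_fixed[OF A \<pi> z] by (simp only:)
    also have "\<dots> = color_op (if cyclic_on (\<sigma> \<circ> \<pi>) A then color_poly (card (orbit \<pi> ` A)) else 0)"
      \<comment> \<open>The empty sum yields \<open>color_op 0 = 0\<close> for the else
        branch.\<close>
      using color_op_sum[of _ "{}"] by simp
    finally show "?g \<pi> = \<dots>" .
  qed simp
  also have "(\<Sum>\<pi> | \<pi> permutes A. ?g (transpose z e \<circ> \<pi>)) = 0"
  proof (rule sum.neutral, rule ballI)
    fix \<pi> assume "\<pi> \<in> {\<pi>. \<pi> permutes A}"
    then have \<pi>: "\<pi> permutes A" by simp
    have "\<sigma> \<circ> transpose z e \<circ> (transpose z e \<circ> \<pi>) = \<sigma> \<circ> \<pi>"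
      by (simp add: fun_eq_iff)
    then show "?g (transpose z e \<circ> \<pi>) = 0"
      using not_cyclic_on_insert_fixed[OF permutes_compose[OF \<pi> \<sigma>] z ne] by (simp only: if_False)
  qed
  also have "(\<Sum>b\<in>A - {e}. \<Sum>\<pi> | \<pi> permutes A. ?g (transpose z b \<circ> \<pi>))
      = (\<Sum>b\<in>A - {e}. colored_sum A (\<sigma> \<circ> transpose b e))"
  proof (rule sum.cong)
    fix b assume "b \<in> A - {e}"
    then have b: "b \<in> A" "b \<noteq> e" "b \<noteq> z" using z by auto
    let ?\<tau> = "\<sigma> \<circ> transpose b e"
    have \<tau>: "?\<tau> permutes A" using b e \<sigma> by (intro permutes_compose permutes_swap_id)
    show "(\<Sum>\<pi> | \<pi> permutes A. ?g (transpose z b \<circ> \<pi>)) = colored_sum A ?\<tau>"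
      unfolding colored_sum_def
    proof (rule sum.cong)
      fix \<pi> assume "\<pi> \<in> {\<pi>. \<pi> permutes A}"
      then have \<pi>: "\<pi> permutes A" by simp
      \<comment> \<open>Conjugating (z b) by (z e) gives (b e), which acts on \<open>A\<close> alone
        and can be absorbed into \<sigma>.\<close>
      have "transpose z e \<circ> transpose z b = transpose b e \<circ> transpose z e"
        using b ze by (auto simp: fun_eq_iff transpose_def)
      then have "\<sigma> \<circ> transpose z e \<circ> (transpose z b \<circ> \<pi>) = ?\<tau> \<circ> transpose z e \<circ> \<pi>"
        by (metis comp_assoc)
      also have "\<dots> = transpose z (?\<tau> e) \<circ> (?\<tau> \<circ> \<pi>)"
        using transpose_comp_eq_comp_transpose[OF \<tau> z, of e] by (metis comp_assoc)
      finally have "\<sigma> \<circ> transpose z e \<circ> (transpose z b \<circ> \<pi>) = \<dots>" .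
      moreover have "?\<tau> e \<in> A" using e \<tau> by (simp only: permutes_in_image)
      ultimately show "?g (transpose z b \<circ> \<pi>)
          = (if cyclic_on (?\<tau> \<circ> \<pi>) A then color_poly (card (orbit \<pi> ` A)) else 0)"
        using cyclic_on_insert_join[OF A permutes_compose[OF \<pi> \<tau>] z]
          card_orbits_insert_join[OF A \<pi> z b(1)] by (simp only:)
    qed simp
  qed simp
  finally show ?thesis by (simp only: add_0)
qed

text \<open>The three summands are the contributions of \<open>color_op\<close>, the cuts and the
  joins. The terms with k - 1 and with A + B cancel between \<open>color_op\<close> and the cuts,
  those with the derivative of \<open>R\<close> between \<open>color_op\<close> and the joins. Only
  multiples of \<open>cycle_poly (k + 1) * R\<close> remain, k from the cuts and
  \<open>card X\<close> from each join.\<close>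

lemma color_op_cycle_poly_mult:
  fixes S :: "'a set set"
  assumes "finite S" and pos: "\<And>X. X \<in> S \<Longrightarrow> 0 < card X"
  defines "R \<equiv> \<Prod>X\<in>S. cycle_poly (card X)"
  shows "color_op (y_poly * (cycle_poly k * R)) +
    y_poly * ((\<Sum>s\<in>{0<..<k}. cycle_poly s * cycle_poly (k - s)) * R +
      (\<Sum>X\<in>S. of_nat (card X) * (cycle_poly (k + card X) * (\<Prod>X'\<in>S - {X}. cycle_poly (card X'))))) =
    of_nat (k + (\<Sum>X\<in>S. card X)) * (y_poly * (cycle_poly (k + 1) * R))"
proof -
  \<comment> \<open>Opaque names keep the coefficient lists out of the ring normalisation.\<close>
  define B A :: "real poly" where "B = y_poly" and "A = [:1, 1:]"
  define D where "D = pderiv R"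
  have dA: "pderiv A = 1" and dB: "pderiv B = 1"
    by (simp_all add: A_def B_def pderiv_pCons one_pCons)
  have 1: "color_op (B * (cycle_poly k * R)) =
      B * ((A + B) * cycle_poly k * R + A * B * (of_nat k * cycle_poly (k - 1) * R + cycle_poly k * D))"
    unfolding color_op_def A_def[symmetric] B_def[symmetric] pderiv_mult dA dB pderiv_cycle_poly D_def
    by (simp add: algebra_simps)
  have 2: "(\<Sum>s\<in>{0<..<k}. cycle_poly s * cycle_poly (k - s)) =
      of_nat k * cycle_poly (k + 1) - (A + B) * cycle_poly k - of_nat k * A * B * cycle_poly (k - 1)"
    using sum_cycle_poly_mult[of k] by (simp only: A_def B_def)
  have 3: "(\<Sum>X\<in>S. of_nat (card X) * (cycle_poly (k + card X) * (\<Prod>X'\<in>S - {X}. cycle_poly (card X')))) =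
      of_nat (\<Sum>X\<in>S. card X) * (cycle_poly (k + 1) * R) - A * B * cycle_poly k * D"
  proof -
    have "of_nat (card X) * (cycle_poly (k + card X) * (\<Prod>X'\<in>S - {X}. cycle_poly (card X'))) =
        of_nat (card X) * (cycle_poly (k + 1) * R) -
        A * B * cycle_poly k * ((\<Prod>X'\<in>S - {X}. cycle_poly (card X')) * pderiv (cycle_poly (card X)))"
      if "X \<in> S" for X
    proof -
      have "R = cycle_poly (card X) * (\<Prod>X'\<in>S - {X}. cycle_poly (card X'))"
        unfolding R_def using assms(1) that by (rule prod.remove)
      then show ?thesis
        unfolding cycle_poly_add[OF pos[OF that]] pderiv_cycle_poly A_def[symmetric] B_def[symmetric]
        by (simp add: algebra_simps)
    qed
    then show ?thesis
      unfolding D_def R_def pderiv_prod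
      by (simp add: sum_subtractf sum_distrib_left sum_distrib_right)
  qed
  show ?thesis
    unfolding B_def[symmetric] 1 2 3 of_nat_add by (simp only: algebra_simps)
qed

text \<open>Inserting \<open>z\<close> multiplies the scalar by \<open>card A\<close> in both cases:
  once as the number of places for \<open>z\<close>, once as the sum of all cycle lengths. The
  product gains \<open>cycle_poly 1 = 1\<close> for a fixed point; otherwise one factor
  \<open>cycle_poly k\<close> becomes \<open>cycle_poly (k + 1)\<close>.\<close>

theorem colored_sum_eq:
  assumes "finite A" "A \<noteq> {}" "\<sigma> permutes A"
  shows "colored_sum A \<sigma> = of_nat (fact (card A - 1)) * (y_poly * orbit_prod cycle_poly A \<sigma>)"
  using assms
proof (induction A arbitrary: \<sigma> rule: finite_ne_induct)
  case (singleton z)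
  then have "\<sigma> = id" by (simp add: permutes_sing)
  moreover have "orbit id z = {z}" by (simp add: orbit_eq_singleton_iff)
  moreover have "color_poly (Suc 0) = y_poly"
    by (simp only: color_poly_Suc) (simp add: color_poly_def color_op_def pderiv_pCons one_pCons)
  moreover have "{\<pi>. \<pi> permutes {z}} = {id}" by (simp add: permutes_sing)
  moreover have "cyclic_on id {z}" by (simp add: cyclic_on_def eq_commute[of "{z}"] orbit_eq_singleton_iff)
  ultimately show ?case
    unfolding colored_sum_def orbit_prod_def by (simp del: color_poly_Suc)
next
  case (insert z A)
  have cA: "of_nat (fact (card A)) = of_nat (card A) * (of_nat (fact (card A - 1)) :: real poly)"
    using insert(1,2) by (cases "card A") (simp_all add: algebra_simps)
  show ?case
  proof (cases "\<sigma> z = z")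
    case True
    then have \<sigma>: "\<sigma> permutes A"
      by (intro permutes_superset[OF insert.prems]) auto
    have "{z} \<notin> orbit \<sigma> ` A"
      using permutes_orbit_subset[OF \<sigma>] insert(3) by auto
    then have "orbit_prod cycle_poly (insert z A) \<sigma> = orbit_prod cycle_poly A \<sigma>"
      unfolding orbit_prod_def orbits_insert_fixed[OF \<sigma> insert(3)] using insert(1) by simp
    then show ?thesis
      using colored_sum_insert_fixed[OF insert(1,2,3) \<sigma>] insert(1,3) insert.IH[OF \<sigma>] cA
      by (simp add: algebra_simps)
  next
    case False
    \<comment> \<open>With \<open>e\<close> the predecessor of \<open>z\<close>, the permutation
      \<tau> below bypasses \<open>z\<close>: it fixes \<open>z\<close> and sends \<open>e\<close>
      to \<open>\<sigma> z\<close>.\<close>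
    define e where "e = inv \<sigma> z"
    have \<sigma>e: "\<sigma> e = z" unfolding e_def using insert.prems by (simp add: permutes_inverses)
    then have e: "e \<in> A"
      using False permutes_in_image[OF insert.prems, of e] by auto
    define \<tau> where "\<tau> = \<sigma> \<circ> transpose z e"
    have "\<tau> permutes insert z A"
      unfolding \<tau>_def using insert.prems e by (intro permutes_compose permutes_swap_id) auto
    then have \<tau>: "\<tau> permutes A"
      by (rule permutes_superset) (auto simp: \<tau>_def \<sigma>e)
    have \<sigma>_eq: "\<sigma> = \<tau> \<circ> transpose z e" by (simp add: \<tau>_def comp_assoc)
    note perm = permutes_permutation[OF insert(1) \<tau>]
    define S k R where "S = orbit \<tau> ` A - {orbit \<tau> e}" and "k = card (orbit \<tau> e)"
      and "R = (\<Prod>X\<in>S. cycle_poly (card X))"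
    have finS: "finite S" using insert(1) by (simp add: S_def)
    have S: "orbit \<tau> ` A = insert (orbit \<tau> e) S" "orbit \<tau> e \<notin> S" using e by (auto simp: S_def)
    have fin: "finite (orbit \<tau> x)" for x
      by (rule finite_orbit) (rule permutation_self_in_orbit[OF perm])
    have pos: "0 < card X" if "X \<in> S" for X
      using that fin orbit_nonempty[of \<tau>] by (auto simp: S_def card_gt_0_iff)
    have W\<tau>: "orbit_prod cycle_poly A \<tau> = cycle_poly k * R"
      unfolding orbit_prod_def S R_def k_def using finS S(2) by simp
    have "\<tau> e \<in> A" using \<tau> e by (simp add: permutes_in_image)
    then have "orbit \<sigma> ` insert z A = insert (insert z (orbit \<tau> e)) S"
      using orbits_insert_join[OF insert(1) \<tau> insert(3), of "\<tau> e"]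
        transpose_comp_eq_comp_transpose[OF \<tau> insert(3), of e] permutation_orbit_step[OF perm, of e]
      by (simp add: \<sigma>_eq S_def)
    moreover have "insert z (orbit \<tau> e) \<notin> S" "z \<notin> orbit \<tau> e"
      using permutes_orbit_subset[OF \<tau>] insert(3) e by (auto simp: S_def)
    ultimately have W\<sigma>: "orbit_prod cycle_poly (insert z A) \<sigma> = cycle_poly (k + 1) * R"
      unfolding orbit_prod_def R_def k_def using finS fin by simp
    have card: "k + (\<Sum>X\<in>S. card X) = card A"
      using sum_card_orbits[OF insert(1) \<tau>, of "\<lambda>_. 1::nat"] finS S by (simp add: k_def)
    have IH: "colored_sum A (\<tau> \<circ> transpose b e)
        = of_nat (fact (card A - 1)) * (y_poly * orbit_prod cycle_poly A (\<tau> \<circ> transpose b e))"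
      if "b \<in> A" for b
      using that e \<tau> by (intro insert.IH permutes_compose permutes_swap_id)
    have "colored_sum (insert z A) \<sigma>
        = color_op (of_nat (fact (card A - 1)) * (y_poly * (cycle_poly k * R))) +
          (\<Sum>b\<in>A - {e}. of_nat (fact (card A - 1)) * (y_poly * orbit_prod cycle_poly A (\<tau> \<circ> transpose b e)))"
      unfolding \<sigma>_eq colored_sum_insert_join[OF insert(1,3) \<tau> e] insert.IH[OF \<tau>] W\<tau>
      using IH by simp
    also have "\<dots> = of_nat (fact (card A - 1)) * (color_op (y_poly * (cycle_poly k * R)) +
          y_poly * (\<Sum>b\<in>A - {e}. orbit_prod cycle_poly A (\<tau> \<circ> transpose b e)))"
      by (simp only: color_op_mult_of_nat sum_distrib_left distrib_left)
    also have "\<dots> = of_nat (fact (card A - 1)) * (of_nat (card A) * (y_poly * (cycle_poly (k + 1) * R)))"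
      unfolding sum_orbit_prod_comp_transpose[OF insert(1) \<tau> e] S_def[symmetric] k_def[symmetric]
      using color_op_cycle_poly_mult[OF finS pos, of k] by (simp only: R_def card)
    also have "\<dots> = of_nat (fact (card A)) * (y_poly * orbit_prod cycle_poly (insert z A) \<sigma>)"
      unfolding W\<sigma> cA by (simp only: mult_ac)
    finally show ?thesis using insert(1,3) by simp
  qed
qed

section \<open>From all long cycles to the standard one\<close>

lemma orbit_conj:
  assumes "bij h"
  shows "orbit (h \<circ> p \<circ> inv h) (h x) = h ` orbit p x"
proof -
  have "((h \<circ> p \<circ> inv h) ^^ k) (h x) = h ((p ^^ k) x)" for k
    using assms by (induction k) (auto simp: bij_is_inj)
  then show ?thesis by (auto simp: orbit_altdef)
qed

lemma orbits_conj:
  assumes "h permutes A"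
  shows "orbit (h \<circ> p \<circ> inv h) ` A = (`) h ` orbit p ` A"
proof -
  have "orbit (h \<circ> p \<circ> inv h) ` A = orbit (h \<circ> p \<circ> inv h) ` h ` A"
    using assms by (simp add: permutes_image)
  then show ?thesis
    using orbit_conj[OF permutes_bij[OF assms]] by (simp add: image_image)
qed

lemma inj_image_permutes: "h permutes A \<Longrightarrow> inj ((`) h)"
  by (simp add: inj_on_image permutes_inj)

lemma num_cycles_conj:
  assumes "h permutes {1..n}"
  shows "num_cycles n (h \<circ> p \<circ> inv h) = num_cycles n p"
  unfolding num_cycles_def cycles_of_def orbits_conj[OF assms]
  by (rule card_image) (rule inj_on_subset[OF inj_image_permutes[OF assms]], simp)

lemma cycle_type_conj:
  assumes "h permutes {1..n}"
  shows "cycle_type n (h \<circ> p \<circ> inv h) = cycle_type n p"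
proof -
  have "mset_set ((`) h ` orbit p ` {1..n}) = image_mset ((`) h) (mset_set (orbit p ` {1..n}))"
    by (rule image_mset_mset_set[symmetric], rule inj_on_subset[OF inj_image_permutes[OF assms]]) simp
  moreover have "card (h ` X) = card X" for X
    using permutes_inj_on[OF assms] by (rule card_image)
  ultimately show ?thesis
    unfolding cycle_type_def cycles_of_def orbits_conj[OF assms]
    by (simp add: multiset.map_comp comp_def)
qed

lemma long_cycle_permutes: "1 \<le> n \<Longrightarrow> long_cycle n permutes {1..n}"
proof (rule bij_imp_permutes)
  have "inj_on (long_cycle n) {1..n}" by (auto simp: inj_on_def long_cycle_def split: if_splits)
  moreover have "long_cycle n ` {1..n} \<subseteq> {1..n}" by (auto simp: long_cycle_def)
  ultimately show "bij_betw (long_cycle n) {1..n} {1..n}"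
    by (simp add: bij_betw_def endo_inj_surj)
next
  fix x assume "1 \<le> n" "x \<notin> {1..n}"
  then show "long_cycle n x = x" by (auto simp: long_cycle_def)
qed

text \<open>The conjugating permutation numbers the points in the order in which \<open>p\<close>
  visits them, starting from 1.\<close>

lemma cyclic_on_conj_long_cycle:
  assumes "1 \<le> n" and p: "p permutes {1..n}" and "cyclic_on p {1..n}"
  obtains h where "h permutes {1..n}" "p = h \<circ> long_cycle n \<circ> inv h"
proof -
  have "orbit p 1 = {1..n}" using assms by (simp add: cyclic_on_alldef)
  moreover have "permutation p" using p by (rule permutes_permutation[rotated]) simp
  moreover from calculation(1) have "card (orbit p 1) = n" by simp
  ultimately have en: "{1..n} = (\<lambda>i. (p ^^ i) 1) ` {..<n}" "inj_on (\<lambda>i. (p ^^ i) 1) {..<n}"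
    "(p ^^ n) 1 = 1"
    using orbit_funpow_enum[of p 1] by (simp_all only:)
  \<comment> \<open>The exponent is k - 1 because numbering starts at 1; the identity outside makes
    \<open>h\<close> a permutation of {1..n}.\<close>
  define h where "h k = (if k \<in> {1..n} then (p ^^ (k - 1)) 1 else k)" for k
  have "bij_betw (\<lambda>k. (p ^^ (k - 1)) 1) {1..n} {1..n}"
  proof -
    have "bij_betw (\<lambda>k. k - 1) {1..n} {..<n}"
      by (rule bij_betw_byWitness[of _ Suc]) auto
    moreover have "bij_betw (\<lambda>i. (p ^^ i) 1) {..<n} {1..n}"
      using en(1,2) by (simp add: bij_betw_def)
    ultimately show ?thesis by (auto dest: bij_betw_trans simp: comp_def)
  qed
  then have "bij_betw h {1..n} {1..n}"
    by (rule bij_betw_cong[THEN iffD1, rotated]) (simp add: h_def)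
  then have h: "h permutes {1..n}"
    by (rule bij_imp_permutes) (auto simp: h_def)
  have "p (h k) = h (long_cycle n k)" for k
  proof (cases "k \<in> {1..n}")
    case True
    then obtain j where k: "k = Suc j" "j < n" by (cases k) auto
    have "p (h k) = (p ^^ k) 1" using True by (simp add: h_def k)
    also have "\<dots> = h (long_cycle n k)"
      using True en(3) assms(1) by (cases "k = n") (auto simp: h_def long_cycle_def)
    finally show ?thesis .
  next
    case False
    then show ?thesis using p assms(1) by (auto simp: h_def long_cycle_def permutes_def)
  qed
  then have "p \<circ> h = h \<circ> long_cycle n" by (simp add: fun_eq_iff)
  then have "p = h \<circ> long_cycle n \<circ> inv h"
    using permutes_inv_o(1)[OF h] by (metis comp_assoc comp_id)
  then show ?thesis using h that by blast
qed

text \<open>Read off from \<open>colored_sum_eq\<close> for the identity: every cycle has length 1,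
  so the polynomial is (|A| - 1)! y, and its linear coefficient counts each long cycle once because
  S(c,1) = 1 for c > 0.\<close>

lemma card_cyclic_permutations:
  assumes "finite A" "A \<noteq> {}"
  shows "card {p. p permutes A \<and> cyclic_on p A} = fact (card A - 1)"
proof -
  have "coeff (colored_sum A id) 1 = (\<Sum>p | p permutes A. if cyclic_on p A then 1 else 0)"
    unfolding colored_sum_def coeff_sum
  proof (rule sum.cong)
    fix p
    have "0 < card (orbit p ` A)" using assms by (simp add: card_gt_0_iff)
    then have "Stirling (card (orbit p ` A)) 1 = 1"
      using Stirling_1[of "card (orbit p ` A) - 1"] by simp
    then show "coeff (if cyclic_on (id \<circ> p) A then color_poly (card (orbit p ` A)) else 0) 1
        = (if cyclic_on p A then 1 else 0)"
      using coeff_color_poly[of "card (orbit p ` A)" 1] by simp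
  qed simp
  also have "\<dots> = real (card {p. p permutes A \<and> cyclic_on p A})"
    using assms finite_permutations[OF assms(1)] by (simp add: sum.If_cases Collect_conj_eq)
  finally have "coeff (colored_sum A id) 1 = \<dots>" .
  moreover have "orbit_prod cycle_poly A id = 1"
  proof -
    have "orbit id x = {x}" for x :: 'a by (simp add: orbit_eq_singleton_iff)
    then show ?thesis by (auto simp: orbit_prod_def intro!: prod.neutral)
  qed
  ultimately have "real (card {p. p permutes A \<and> cyclic_on p A}) = fact (card A - 1)"
    using colored_sum_eq[OF assms permutes_id] by (simp add: of_nat_poly coeff_pCons)
  then show ?thesis by (metis of_nat_eq_iff of_nat_fact)
qed

section \<open>The generating polynomial of a conjugacy class\<close>

definition perms_of_type :: "nat \<Rightarrow> nat multiset \<Rightarrow> (nat \<Rightarrow> nat) set" where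
  "perms_of_type n \<gamma> = {p. p permutes {1..n} \<and> cycle_type n p = \<gamma>}"

lemma finite_perms_of_type: "finite (perms_of_type n \<gamma>)"
  by (rule finite_subset[OF _ finite_permutations[of "{1..n}"]]) (auto simp: perms_of_type_def)

lemma conj_perms_of_type:
  assumes "h permutes {1..n}" "p \<in> perms_of_type n \<gamma>"
  shows "h \<circ> p \<circ> inv h \<in> perms_of_type n \<gamma>"
  using assms unfolding perms_of_type_def
  by (auto simp: cycle_type_conj intro!: permutes_compose permutes_inv)

lemma bij_betw_conj_perms_of_type:
  assumes h: "h permutes {1..n}"
  shows "bij_betw (\<lambda>p. h \<circ> p \<circ> inv h) (perms_of_type n \<gamma>) (perms_of_type n \<gamma>)"
proof (rule bij_betw_byWitness[of _ "\<lambda>p. inv h \<circ> p \<circ> h"])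
  have inv: "inv h \<circ> h = id" "h \<circ> inv h = id"
    using permutes_inv_o[OF h] by auto
  show "\<forall>p\<in>perms_of_type n \<gamma>. inv h \<circ> (h \<circ> p \<circ> inv h) \<circ> h = p"
    "\<forall>p\<in>perms_of_type n \<gamma>. h \<circ> (inv h \<circ> p \<circ> h) \<circ> inv h = p"
    using inv by (metis comp_assoc comp_id id_comp)+
  show "(\<lambda>p. h \<circ> p \<circ> inv h) ` perms_of_type n \<gamma> \<subseteq> perms_of_type n \<gamma>"
    using conj_perms_of_type[OF h] by auto
  show "(\<lambda>p. inv h \<circ> p \<circ> h) ` perms_of_type n \<gamma> \<subseteq> perms_of_type n \<gamma>"
    using conj_perms_of_type[OF permutes_inv[OF h]] permutes_inv_inv[OF h] by auto
qed

lemma orbit_prod_eq_prod_mset: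
  "orbit_prod w {1..n} p = prod_mset (image_mset w (cycle_type n p))"
  by (simp add: orbit_prod_def cycle_type_def cycles_of_def prod_unfold_prod_mset multiset.map_comp comp_def)

text \<open>For given \<sigma>, the only second factor is
  \<open>inv \<sigma> \<circ> long_cycle n\<close>, so the factorisations counted by
  \<open>mu\<close> are indexed by \<sigma> alone.\<close>

definition type_poly :: "nat \<Rightarrow> nat multiset \<Rightarrow> real poly" where
  "type_poly n \<gamma> = (\<Sum>\<sigma>\<in>perms_of_type n \<gamma>. color_poly (num_cycles n (inv \<sigma> \<circ> long_cycle n)))"

lemma colored_sum_eq_sum_cyclic:
  assumes "\<sigma> permutes {1..n}"
  shows "colored_sum {1..n} \<sigma> =
    (\<Sum>\<omega> | \<omega> permutes {1..n} \<and> cyclic_on \<omega> {1..n}. color_poly (num_cycles n (inv \<sigma> \<circ> \<omega>)))"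
proof -
  have inv: "\<sigma> \<circ> inv \<sigma> = id" using permutes_inv_o[OF assms] by auto
  have "colored_sum {1..n} \<sigma> = (\<Sum>\<omega> | \<omega> permutes {1..n}.
     if cyclic_on (\<sigma> \<circ> (inv \<sigma> \<circ> \<omega>)) {1..n} then color_poly (card (orbit (inv \<sigma> \<circ> \<omega>) ` {1..n})) else 0)"
    unfolding colored_sum_def
    by (rule setum_permutations_compose_left) (use assms permutes_inv in auto)
  also have "\<dots> = (\<Sum>\<omega> | \<omega> permutes {1..n}.
     if cyclic_on \<omega> {1..n} then color_poly (num_cycles n (inv \<sigma> \<circ> \<omega>)) else 0)"
    by (simp only: comp_assoc[symmetric] inv id_comp num_cycles_def cycles_of_def)
  also have "\<dots> = (\<Sum>\<omega> | \<omega> permutes {1..n} \<and> cyclic_on \<omega> {1..n}. color_poly (num_cycles n (inv \<sigma> \<circ> \<omega>)))"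
    using finite_permutations[of "{1..n}"] by (subst sum.inter_filter[symmetric]) (simp_all add: Collect_conj_eq)
  finally show ?thesis .
qed

text \<open>Conjugating \<sigma> and the long cycle simultaneously by \<open>h\<close> conjugates
  the second factor too, and permutes the class of \<gamma>.\<close>

lemma type_poly_conj:
  assumes h: "h permutes {1..n}"
  shows "(\<Sum>\<sigma>\<in>perms_of_type n \<gamma>. color_poly (num_cycles n (inv \<sigma> \<circ> (h \<circ> long_cycle n \<circ> inv h)))) = type_poly n \<gamma>"
proof -
  have "type_poly n \<gamma> = (\<Sum>\<sigma>\<in>perms_of_type n \<gamma>.
      color_poly (num_cycles n (inv (h \<circ> \<sigma> \<circ> inv h) \<circ> (h \<circ> long_cycle n \<circ> inv h))))"
    unfolding type_poly_def
  proof (rule sum.cong)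
    fix \<sigma> assume "\<sigma> \<in> perms_of_type n \<gamma>"
    then have \<sigma>: "\<sigma> permutes {1..n}" by (simp add: perms_of_type_def)
    have "inv (h \<circ> \<sigma> \<circ> inv h) = h \<circ> inv \<sigma> \<circ> inv h"
      using permutes_bij[OF h] permutes_bij[OF \<sigma>] permutes_bij[OF permutes_inv[OF h]]
      by (simp add: o_inv_distrib bij_comp inv_inv_eq comp_assoc)
    moreover have "inv h \<circ> h = id" using permutes_inv_o[OF h] by auto
    ultimately have "inv (h \<circ> \<sigma> \<circ> inv h) \<circ> (h \<circ> long_cycle n \<circ> inv h) = h \<circ> (inv \<sigma> \<circ> long_cycle n) \<circ> inv h"
      by (metis comp_assoc comp_id)
    then show "color_poly (num_cycles n (inv \<sigma> \<circ> long_cycle n)) =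
        color_poly (num_cycles n (inv (h \<circ> \<sigma> \<circ> inv h) \<circ> (h \<circ> long_cycle n \<circ> inv h)))"
      by (simp only: num_cycles_conj[OF h])
  qed simp
  also have "\<dots> = (\<Sum>\<sigma>\<in>perms_of_type n \<gamma>. color_poly (num_cycles n (inv \<sigma> \<circ> (h \<circ> long_cycle n \<circ> inv h))))"
    by (rule sum.reindex_bij_betw[OF bij_betw_conj_perms_of_type[OF h]])
  finally show ?thesis ..
qed

text \<open>Summed over all (n - 1)! long cycles, \<open>type_poly\<close> is the same for each.
  Exchanging the sums turns the inner one into \<open>colored_sum\<close>, which depends only on the
  cycle type, and (n - 1)! cancels.\<close>

lemma type_poly_eq:
  assumes n: "1 \<le> n"
  shows "type_poly n \<gamma> =
    of_nat (card (perms_of_type n \<gamma>)) * (y_poly * prod_mset (image_mset cycle_poly \<gamma>))"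
proof -
  let ?C = "{\<omega>. \<omega> permutes {1..n} \<and> cyclic_on \<omega> {1..n}}"
  have "of_nat (fact (n - 1)) * type_poly n \<gamma> = (\<Sum>\<omega>\<in>?C. type_poly n \<gamma>)"
    using card_cyclic_permutations[of "{1..n}"] n by (simp only: sum_constant) simp
  also have "\<dots> = (\<Sum>\<omega>\<in>?C. \<Sum>\<sigma>\<in>perms_of_type n \<gamma>. color_poly (num_cycles n (inv \<sigma> \<circ> \<omega>)))"
  proof (rule sum.cong)
    fix \<omega> assume "\<omega> \<in> ?C"
    then obtain h where "h permutes {1..n}" "\<omega> = h \<circ> long_cycle n \<circ> inv h"
      using cyclic_on_conj_long_cycle[OF n] by blast
    then show "type_poly n \<gamma> = (\<Sum>\<sigma>\<in>perms_of_type n \<gamma>. color_poly (num_cycles n (inv \<sigma> \<circ> \<omega>)))"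
      using type_poly_conj by simp
  qed simp
  also have "\<dots> = (\<Sum>\<sigma>\<in>perms_of_type n \<gamma>. colored_sum {1..n} \<sigma>)"
    by (subst sum.swap, rule sum.cong[OF refl], rule colored_sum_eq_sum_cyclic[symmetric])
      (simp add: perms_of_type_def)
  also have "\<dots> = (\<Sum>\<sigma>\<in>perms_of_type n \<gamma>.
      of_nat (fact (n - 1)) * (y_poly * prod_mset (image_mset cycle_poly \<gamma>)))"
  proof (rule sum.cong)
    fix \<sigma> assume "\<sigma> \<in> perms_of_type n \<gamma>"
    then have "\<sigma> permutes {1..n}" "cycle_type n \<sigma> = \<gamma>" by (simp_all add: perms_of_type_def)
    then show "colored_sum {1..n} \<sigma> =
        of_nat (fact (n - 1)) * (y_poly * prod_mset (image_mset cycle_poly \<gamma>))"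
      using colored_sum_eq[of "{1..n}" \<sigma>] n orbit_prod_eq_prod_mset[of cycle_poly n \<sigma>] by simp
  qed simp
  also have "\<dots> = of_nat (fact (n - 1)) *
      (of_nat (card (perms_of_type n \<gamma>)) * (y_poly * prod_mset (image_mset cycle_poly \<gamma>)))"
    by (simp only: sum_constant mult_ac)
  finally show ?thesis by (rule mult_left_cancel[THEN iffD1, rotated]) simp
qed

section \<open>Conjugacy class sizes\<close>

lemma count_cycle_type:
  "count (cycle_type n p) i = card {X \<in> orbit p ` {1..n}. card X = i}"
  by (simp add: cycle_type_def cycles_of_def count_conv_size_mset filter_mset_image_mset)

lemma card_points_in_cycles:
  assumes "p permutes {1..n}"
  shows "card {b \<in> {1..n}. card (orbit p b) = i} = i * count (cycle_type n p) i"
proof -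
  have "card {b \<in> {1..n}. card (orbit p b) = i} = (\<Sum>b\<in>{1..n}. if card (orbit p b) = i then 1 else 0)"
    by (simp add: sum.If_cases Int_def)
  also have "\<dots> = (\<Sum>X\<in>orbit p ` {1..n}. card X * (if card X = i then 1 else 0))"
    using sum_card_orbits[OF _ assms, of "\<lambda>k. if k = i then 1 else 0 :: nat"] by simp
  also have "\<dots> = (\<Sum>X\<in>orbit p ` {1..n}. if card X = i then i else 0)"
    by (rule sum.cong) auto
  also have "\<dots> = (\<Sum>X\<in>{X \<in> orbit p ` {1..n}. card X = i}. i)"
    by (rule sum.inter_filter[symmetric]) simp
  also have "\<dots> = i * count (cycle_type n p) i"
    by (simp add: count_cycle_type mult.commute)
  finally show ?thesis .
qed

text \<open>Conjugation by \<open>transpose x y\<close> is a bijection of the class that carries the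
  cycle of \<open>x\<close> to that of \<open>y\<close>.\<close>

lemma card_perms_of_type_orbit_eq:
  assumes "x \<in> {1..n}" "y \<in> {1..n}"
  shows "card {p \<in> perms_of_type n \<gamma>. card (orbit p x) = i} = card {p \<in> perms_of_type n \<gamma>. card (orbit p y) = i}"
proof -
  let ?h = "transpose x y"
  have h: "?h permutes {1..n}" using assms by (rule permutes_swap_id)
  have orb: "card (orbit (?h \<circ> p \<circ> inv ?h) y) = card (orbit p x)" for p :: "nat \<Rightarrow> nat"
  proof -
    have "orbit (?h \<circ> p \<circ> inv ?h) y = ?h ` orbit p x"
      using orbit_conj[OF permutes_bij[OF h], of p x] by simp
    then show ?thesis by (simp add: card_image)
  qed
  have "bij_betw (\<lambda>p. ?h \<circ> p \<circ> inv ?h) {p \<in> perms_of_type n \<gamma>. card (orbit p x) = i}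
      {p \<in> perms_of_type n \<gamma>. card (orbit p y) = i}"
  proof -
    note bij = bij_betw_conj_perms_of_type[OF h, of \<gamma>]
    have "{p \<in> (\<lambda>p. ?h \<circ> p \<circ> inv ?h) ` perms_of_type n \<gamma>. card (orbit p y) = i} =
        {p \<in> perms_of_type n \<gamma>. card (orbit p y) = i}"
      by (simp only: bij_betw_imp_surj_on[OF bij])
    moreover have "(\<lambda>p. ?h \<circ> p \<circ> inv ?h) ` {p \<in> perms_of_type n \<gamma>. card (orbit p x) = i} =
        {p \<in> (\<lambda>p. ?h \<circ> p \<circ> inv ?h) ` perms_of_type n \<gamma>. card (orbit p y) = i}"
      using orb by auto
    ultimately show ?thesis
      by (intro bij_betw_subset[OF bij]) auto
  qed
  then show ?thesis by (rule bij_betw_same_card)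
qed

text \<open>Both sides count the pairs of a permutation of type \<gamma> and a point in one of its
  cycles of length \<open>i\<close>; by symmetry every point occurs as often as
  \<open>z\<close>.\<close>

lemma card_perms_of_type_eq_card_orbit:
  assumes "z \<in> {1..n}"
  shows "i * count \<gamma> i * card (perms_of_type n \<gamma>) = n * card {p \<in> perms_of_type n \<gamma>. card (orbit p z) = i}"
proof -
  have "i * count \<gamma> i * card (perms_of_type n \<gamma>) = (\<Sum>p\<in>perms_of_type n \<gamma>. card {b \<in> {1..n}. card (orbit p b) = i})"
  proof -
    have "card {b \<in> {1..n}. card (orbit p b) = i} = i * count \<gamma> i" if "p \<in> perms_of_type n \<gamma>" for p
      using that card_points_in_cycles[of p n i] by (simp add: perms_of_type_def)
    then show ?thesis by (simp add: mult.commute)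
  qed
  also have "\<dots> = (\<Sum>p\<in>perms_of_type n \<gamma>. \<Sum>b\<in>{1..n}. if card (orbit p b) = i then 1 else 0)"
    by (simp add: sum.If_cases Int_def)
  also have "\<dots> = (\<Sum>b\<in>{1..n}. \<Sum>p\<in>perms_of_type n \<gamma>. if card (orbit p b) = i then 1 else 0)"
    by (rule sum.swap)
  also have "\<dots> = (\<Sum>b\<in>{1..n}. card {p \<in> perms_of_type n \<gamma>. card (orbit p b) = i})"
    using finite_perms_of_type[of n \<gamma>] by (simp add: sum.If_cases Int_def)
  also have "\<dots> = (\<Sum>b\<in>{1..n}. card {p \<in> perms_of_type n \<gamma>. card (orbit p z) = i})"
    by (rule sum.cong[OF refl], rule card_perms_of_type_orbit_eq) (use assms in auto)
  finally show ?thesis by simp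
qed

section \<open>Cycle types and the insertion of a largest point\<close>

lemma orbit_insert_join:
  assumes "finite A" "p permutes A" "z \<notin> A" "w \<in> A"
  shows "orbit (transpose z w \<circ> p) z = insert z (orbit p w)"
proof -
  let ?q = "transpose z w \<circ> p"
  have "?q permutes insert z A"
    using assms by (intro permutes_compose permutes_swap_id permutes_subset[OF assms(2)]) auto
  then have z: "z \<in> orbit ?q z"
    using assms(1) by (intro permutation_self_in_orbit permutes_permutation[of "insert z A"]) auto
  have "orbit ?q z \<in> insert (insert z (orbit p w)) (orbit p ` A - {orbit p w})"
    unfolding orbits_insert_join[OF assms, symmetric] by simp
  then show ?thesis
    using z assms(3) permutes_orbit_subset[OF assms(2)] by auto
qed

text \<open>One part grows by 1. Adding the old part on the left and the new one on the right avoids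
  multiset difference.\<close>

lemma cycle_type_insert_join:
  assumes p: "p permutes {1..n}" and b: "b \<in> {1..n}"
  shows "add_mset (card (orbit p b)) (cycle_type (Suc n) (transpose (Suc n) b \<circ> p))
    = add_mset (Suc (card (orbit p b))) (cycle_type n p)"
proof -
  let ?S = "orbit p ` {1..n}" and ?X = "orbit p b"
  have ins: "{1..Suc n} = insert (Suc n) {1..n}" by auto
  have sub: "?X \<subseteq> {1..n}" using permutes_orbit_subset[OF p b] .
  have notin: "Suc n \<notin> Y" if "Y \<in> ?S" for Y
    using that permutes_orbit_subset[OF p] by fastforce
  have X: "?X \<in> ?S" using b by simp
  have "orbit (transpose (Suc n) b \<circ> p) ` {1..Suc n} = insert (insert (Suc n) ?X) (?S - {?X})"
    unfolding ins by (rule orbits_insert_join) (use p b in auto)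
  moreover have "insert (Suc n) ?X \<notin> ?S - {?X}" using notin by auto
  moreover have "card (insert (Suc n) ?X) = Suc (card ?X)"
    using notin[OF X] finite_subset[OF sub] by simp
  ultimately have "cycle_type (Suc n) (transpose (Suc n) b \<circ> p)
      = add_mset (Suc (card ?X)) (image_mset card (mset_set (?S - {?X})))"
    by (simp add: cycle_type_def cycles_of_def)
  moreover have "mset_set ?S = add_mset ?X (mset_set (?S - {?X}))"
    using X by (intro mset_set.remove) simp
  ultimately show ?thesis
    by (simp add: cycle_type_def cycles_of_def)
qed

lemma cycle_type_insert_fixed:
  assumes p: "p permutes {1..n}"
  shows "cycle_type (Suc n) p = add_mset 1 (cycle_type n p)"
proof -
  let ?S = "orbit p ` {1..n}"
  have ins: "{1..Suc n} = insert (Suc n) {1..n}" by auto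
  have "Suc n \<notin> Y" if "Y \<in> ?S" for Y
    using that permutes_orbit_subset[OF p] by fastforce
  then have "{Suc n} \<notin> ?S" by blast
  moreover have "orbit p ` {1..Suc n} = insert {Suc n} ?S"
    unfolding ins by (rule orbits_insert_fixed) (use p in auto)
  ultimately show ?thesis
    by (simp add: cycle_type_def cycles_of_def)
qed

lemma card_perms_of_type_orbit_Suc:
  "card {p \<in> perms_of_type (Suc n) \<gamma>. card (orbit p (Suc n)) = i} =
    (\<Sum>q | q permutes {1..n}. if add_mset 1 (cycle_type n q) = \<gamma> \<and> i = 1 then 1 else 0) +
    (\<Sum>b\<in>{1..n}. \<Sum>q | q permutes {1..n}.
      if cycle_type (Suc n) (transpose (Suc n) b \<circ> q) = \<gamma> \<and> i = Suc (card (orbit q b)) then 1 else 0)"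
proof -
  let ?f = "\<lambda>p. if cycle_type (Suc n) p = \<gamma> \<and> card (orbit p (Suc n)) = i then 1 else 0 :: nat"
  have ins: "{1..Suc n} = insert (Suc n) {1..n}" by auto
  have "card {p \<in> perms_of_type (Suc n) \<gamma>. card (orbit p (Suc n)) = i} = sum ?f {p. p permutes {1..Suc n}}"
    using finite_permutations[of "{1..Suc n}"]
    by (simp add: perms_of_type_def sum.If_cases Int_def conj_assoc)
  also have "\<dots> = (\<Sum>b\<in>insert (Suc n) {1..n}. \<Sum>q | q permutes {1..n}. ?f (transpose (Suc n) b \<circ> q))"
    unfolding ins by (rule sum_over_permutations_insert) auto
  also have "\<dots> = (\<Sum>q | q permutes {1..n}. ?f (transpose (Suc n) (Suc n) \<circ> q)) +
      (\<Sum>b\<in>{1..n}. \<Sum>q | q permutes {1..n}. ?f (transpose (Suc n) b \<circ> q))"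
    by (rule sum.insert) auto
  also have "(\<Sum>q | q permutes {1..n}. ?f (transpose (Suc n) (Suc n) \<circ> q)) =
      (\<Sum>q | q permutes {1..n}. if add_mset 1 (cycle_type n q) = \<gamma> \<and> i = 1 then 1 else 0)"
  proof (rule sum.cong)
    fix q assume "q \<in> {q. q permutes {1..n}}"
    then have q: "q permutes {1..n}" by simp
    have "orbit q (Suc n) = {Suc n}"
      using permutes_not_in[OF q, of "Suc n"] by (simp add: orbit_eq_singleton_iff)
    then have "card (orbit q (Suc n)) = 1" by simp
    moreover have "transpose (Suc n) (Suc n) \<circ> q = q" by simp
    ultimately show "?f (transpose (Suc n) (Suc n) \<circ> q) =
        (if add_mset 1 (cycle_type n q) = \<gamma> \<and> i = 1 then 1 else 0)"
      by (simp only: cycle_type_insert_fixed[OF q] eq_commute[of 1 i])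
  qed simp
  also have "(\<Sum>b\<in>{1..n}. \<Sum>q | q permutes {1..n}. ?f (transpose (Suc n) b \<circ> q)) =
    (\<Sum>b\<in>{1..n}. \<Sum>q | q permutes {1..n}.
      if cycle_type (Suc n) (transpose (Suc n) b \<circ> q) = \<gamma> \<and> i = Suc (card (orbit q b)) then 1 else 0)"
  proof (intro sum.cong refl)
    fix b q assume b: "b \<in> {1..n}" and "q \<in> {q. q permutes {1..n}}"
    then have q: "q permutes {1..n}" by simp
    have "orbit (transpose (Suc n) b \<circ> q) (Suc n) = insert (Suc n) (orbit q b)"
      by (rule orbit_insert_join[OF _ q _ b]) auto
    moreover have "orbit q b \<subseteq> {1..n}" using permutes_orbit_subset[OF q b] .
    ultimately have "card (orbit (transpose (Suc n) b \<circ> q) (Suc n)) = Suc (card (orbit q b))"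
      by (subst card_insert_disjoint[symmetric]) (auto intro: finite_subset)
    then show "?f (transpose (Suc n) b \<circ> q) =
      (if cycle_type (Suc n) (transpose (Suc n) b \<circ> q) = \<gamma> \<and> i = Suc (card (orbit q b)) then 1 else 0)"
      by auto
  qed
  finally show ?thesis .
qed

text \<open>Only the sum for a fixed largest point survives, since inserting it into a cycle makes
  that cycle longer than 1.\<close>

lemma card_perms_of_type_fixing:
  assumes "1 \<in># \<gamma>"
  shows "card {p \<in> perms_of_type (Suc n) \<gamma>. card (orbit p (Suc n)) = 1} = card (perms_of_type n (\<gamma> - {#1#}))"
proof -
  have "card (orbit q b) \<noteq> 0" if "q permutes {1..n}" for q b
    using finite_orbit[OF permutation_self_in_orbit[OF permutes_permutation[OF _ that]], of b]
      orbit_nonempty[of q b] by simp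
  then have "(\<Sum>b\<in>{1..n}. \<Sum>q | q permutes {1..n}.
      if cycle_type (Suc n) (transpose (Suc n) b \<circ> q) = \<gamma> \<and> 1 = Suc (card (orbit q b)) then 1 else 0 :: nat) = 0"
    by (intro sum.neutral ballI) auto
  moreover have "add_mset 1 (cycle_type n q) = \<gamma> \<longleftrightarrow> cycle_type n q = \<gamma> - {#1#}" for q
    using assms by (metis add_mset_remove_trivial insert_DiffM)
  ultimately show ?thesis
    unfolding card_perms_of_type_orbit_Suc using finite_permutations[of "{1..n}"]
    by (simp add: perms_of_type_def sum.If_cases Int_def)
qed

text \<open>Deleting the largest point shortens its cycle from j + 1 to j. Conversely, it can be
  inserted before any point lying in a cycle of length j, of which there are
  \<open>j * count \<gamma>' j\<close>.\<close>

lemma card_perms_of_type_moving: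
  assumes "Suc j \<in># \<gamma>" "0 < j"
  defines "\<gamma>' \<equiv> add_mset j (\<gamma> - {#Suc j#})"
  shows "card {p \<in> perms_of_type (Suc n) \<gamma>. card (orbit p (Suc n)) = Suc j}
    = j * count \<gamma>' j * card (perms_of_type n \<gamma>')"
proof -
  have iff: "cycle_type (Suc n) (transpose (Suc n) b \<circ> q) = \<gamma> \<longleftrightarrow> cycle_type n q = \<gamma>'"
    if "q permutes {1..n}" "b \<in> {1..n}" "card (orbit q b) = j" for q b
  proof -
    have eq: "add_mset j (cycle_type (Suc n) (transpose (Suc n) b \<circ> q)) = add_mset (Suc j) (cycle_type n q)"
      using cycle_type_insert_join[OF that(1,2)] that(3) by simp
    have "add_mset (Suc j) \<gamma>' = add_mset j \<gamma>"
      using assms(1) by (simp add: \<gamma>'_def add_mset_commute)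
    then show ?thesis using eq by (metis add_mset_add_mset_same_iff)
  qed
  have iff': "(cycle_type (Suc n) (transpose (Suc n) b \<circ> q) = \<gamma> \<and> Suc j = Suc (card (orbit q b)))
      \<longleftrightarrow> (cycle_type n q = \<gamma>' \<and> card (orbit q b) = j)"
    if "b \<in> {1..n}" "q \<in> {q. q permutes {1..n}}" for b q
    using iff[of q b] that by blast
  have "card {p \<in> perms_of_type (Suc n) \<gamma>. card (orbit p (Suc n)) = Suc j}
    = (\<Sum>b\<in>{1..n}. \<Sum>q | q permutes {1..n}.
      if cycle_type (Suc n) (transpose (Suc n) b \<circ> q) = \<gamma> \<and> Suc j = Suc (card (orbit q b)) then 1 else 0)"
    unfolding card_perms_of_type_orbit_Suc using assms(2) by simp
  also have "\<dots> = (\<Sum>b\<in>{1..n}. \<Sum>q | q permutes {1..n}. if cycle_type n q = \<gamma>' \<and> card (orbit q b) = j then 1 else 0)"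
    by (intro sum.cong refl if_cong iff')
  also have "\<dots> = (\<Sum>q | q permutes {1..n}. \<Sum>b\<in>{1..n}. if cycle_type n q = \<gamma>' \<and> card (orbit q b) = j then 1 else 0)"
    by (rule sum.swap)
  also have "\<dots> = (\<Sum>q | q permutes {1..n}. if cycle_type n q = \<gamma>' then j * count \<gamma>' j else 0)"
  proof (rule sum.cong)
    fix q assume "q \<in> {q. q permutes {1..n}}"
    then have "card {b \<in> {1..n}. card (orbit q b) = j} = j * count (cycle_type n q) j"
      using card_points_in_cycles[of q n j] by (simp only: mem_Collect_eq)
    then show "(\<Sum>b\<in>{1..n}. if cycle_type n q = \<gamma>' \<and> card (orbit q b) = j then 1 else 0) =
        (if cycle_type n q = \<gamma>' then j * count \<gamma>' j else 0)"
      by (simp add: sum.If_cases Int_def)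
  qed simp
  also have "\<dots> = j * count \<gamma>' j * card (perms_of_type n \<gamma>')"
    using finite_permutations[of "{1..n}"]
    by (simp add: perms_of_type_def sum.If_cases Int_def)
  finally show ?thesis .
qed

text \<open>For partitions this is the quotient of the class sizes n!/z, where z is the product of
  the k^{a_k} a_k!. The induction shortens the chosen part by one point at a time until it is 1 and
  then drops it.\<close>

theorem card_perms_of_type_remove:
  assumes "1 \<le> i" "i \<le> n" "i \<in># \<gamma>"
  shows "i * count \<gamma> i * card (perms_of_type n \<gamma>) * fact (n - i)
    = fact n * card (perms_of_type (n - i) (\<gamma> - {#i#}))"
  using assms
proof (induction i arbitrary: n \<gamma> rule: nat_induct_at_least)
  case base
  then obtain n' where n: "n = Suc n'" by (cases n) auto
  show ?case
    using card_perms_of_type_eq_card_orbit[of n n 1 \<gamma>] card_perms_of_type_fixing[of \<gamma> n'] base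
    by (simp add: n algebra_simps)
next
  case (Suc j)
  then obtain n' where n: "n = Suc n'" "j \<le> n'" by (cases n) auto
  \<comment> \<open>The factor \<open>j * count \<gamma>' j\<close> from the shortening is the one
    on the left of the induction hypothesis for \<gamma>', and removing \<open>j\<close> from
    \<gamma>' leaves \<open>\<gamma> - {#Suc j#}\<close>.\<close>
  define \<gamma>' where "\<gamma>' = add_mset j (\<gamma> - {#Suc j#})"
  have "Suc j * count \<gamma> (Suc j) * card (perms_of_type n \<gamma>) * fact (n - Suc j)
      = n * (j * count \<gamma>' j * card (perms_of_type n' \<gamma>')) * fact (n' - j)"
    using card_perms_of_type_eq_card_orbit[of n n "Suc j" \<gamma>] card_perms_of_type_moving[of j \<gamma> n'] Suc
    by (simp add: n \<gamma>'_def)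
  also have "\<dots> = n * (j * count \<gamma>' j * card (perms_of_type n' \<gamma>') * fact (n' - j))"
    by (simp only: mult.assoc)
  also have "\<dots> = n * (fact n' * card (perms_of_type (n' - j) (\<gamma>' - {#j#})))"
    using Suc.IH[OF n(2), of \<gamma>'] by (simp add: \<gamma>'_def)
  also have "\<dots> = fact n * card (perms_of_type (n - Suc j) (\<gamma> - {#Suc j#}))"
    by (simp add: n \<gamma>'_def algebra_simps)
  finally show ?case .
qed

section \<open>The recurrence\<close>

lemma mu_eq_card:
  assumes "1 \<le> n"
  shows "mu n l \<gamma> = card {\<sigma> \<in> perms_of_type n \<gamma>. num_cycles n (inv \<sigma> \<circ> long_cycle n) = l}"
proof -
  let ?M = "{(\<sigma>, \<pi>). \<sigma> permutes {1..n} \<and> \<pi> permutes {1..n} \<and>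
       \<sigma> \<circ> \<pi> = long_cycle n \<and> cycle_type n \<sigma> = \<gamma> \<and> num_cycles n \<pi> = l}"
  have inv: "\<sigma> \<circ> inv \<sigma> = id" "inv \<sigma> \<circ> \<sigma> = id" if "\<sigma> permutes {1..n}" for \<sigma>
    using permutes_inv_o[OF that] by auto
  have "bij_betw fst ?M {\<sigma> \<in> perms_of_type n \<gamma>. num_cycles n (inv \<sigma> \<circ> long_cycle n) = l}"
  proof (rule bij_betw_byWitness[of _ "\<lambda>\<sigma>. (\<sigma>, inv \<sigma> \<circ> long_cycle n)"])
    have eq: "inv \<sigma> \<circ> long_cycle n = \<pi>" if "(\<sigma>, \<pi>) \<in> ?M" for \<sigma> \<pi>
    proof -
      have "\<sigma> permutes {1..n}" and lc: "long_cycle n = \<sigma> \<circ> \<pi>" using that by auto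
      then have "inv \<sigma> \<circ> \<sigma> \<circ> \<pi> = \<pi>" using inv(2) by simp
      then show ?thesis by (simp only: lc comp_assoc)
    qed
    then show "\<forall>a\<in>?M. (fst a, inv (fst a) \<circ> long_cycle n) = a" by auto
    show "fst ` ?M \<subseteq> {\<sigma> \<in> perms_of_type n \<gamma>. num_cycles n (inv \<sigma> \<circ> long_cycle n) = l}"
      using eq by (auto simp: perms_of_type_def)
    have "\<sigma> \<circ> (inv \<sigma> \<circ> long_cycle n) = long_cycle n" if "\<sigma> permutes {1..n}" for \<sigma>
      using inv(1)[OF that] by (simp add: comp_assoc[symmetric])
    then show "(\<lambda>\<sigma>. (\<sigma>, inv \<sigma> \<circ> long_cycle n)) `
        {\<sigma> \<in> perms_of_type n \<gamma>. num_cycles n (inv \<sigma> \<circ> long_cycle n) = l} \<subseteq> ?M"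
      using permutes_compose[OF long_cycle_permutes[OF assms] permutes_inv]
      by (auto simp: perms_of_type_def)
  qed simp
  then show ?thesis unfolding mu_def by (rule bij_betw_same_card)
qed

text \<open>The class is grouped by the cycle count of the second factor, which lies between 1 and
  n.\<close>

lemma coeff_type_poly:
  assumes "1 \<le> n"
  shows "coeff (type_poly n \<gamma>) m = (\<Sum>l\<in>{1..n}. fact m * real (Stirling l m) * real (mu n l \<gamma>))"
proof -
  let ?g = "\<lambda>\<sigma>. num_cycles n (inv \<sigma> \<circ> long_cycle n)"
  have "?g ` perms_of_type n \<gamma> \<subseteq> {1..n}"
    using assms card_image_le[of "{1..n}"] by (auto simp: num_cycles_def cycles_of_def Suc_le_eq card_gt_0_iff)
  then have "coeff (type_poly n \<gamma>) m =
      (\<Sum>l\<in>{1..n}. \<Sum>\<sigma>\<in>{\<sigma> \<in> perms_of_type n \<gamma>. ?g \<sigma> = l}. fact m * real (Stirling (?g \<sigma>) m))"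
    unfolding type_poly_def coeff_sum coeff_color_poly
    by (intro sum.group[symmetric] finite_perms_of_type) auto
  also have "\<dots> = (\<Sum>l\<in>{1..n}. fact m * real (Stirling l m) * real (mu n l \<gamma>))"
    by (rule sum.cong) (simp_all add: mu_eq_card[OF assms])
  finally show ?thesis .
qed

text \<open>The factor 1/l! of \<open>S_tilde\<close> cancels l! in \<open>mu_tilde\<close>; the
  remaining sums over l are coefficients of \<open>type_poly\<close>.\<close>

lemma sum_S_tilde_mu_tilde:
  assumes "1 \<le> n"
  shows "(\<Sum>l\<in>{1..n}. S_tilde m i l * mu_tilde n l \<gamma>) =
    (\<Sum>j = 1..i. real (i choose j) *
      (if m + j < i then 0 else coeff (type_poly n \<gamma>) (m + j - i))) / fact n"
proof -
  \<comment> \<open>For r > l both sides vanish, because the Stirling number is 0; a negative r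
    corresponds to \<open>m + j < i\<close>.\<close>
  have S: "(let r = int m + int j - int i in
      if r < 0 \<or> r > int l then 0 else fact (nat r) * real (Stirling l (nat r)) / fact l) =
      (if m + j < i then 0 else fact (m + j - i) * real (Stirling l (m + j - i)) / fact l)" for j l
  proof -
    have "nat (int m + int j - int i) = m + j - i" by simp
    then show ?thesis by (auto simp: Let_def)
  qed
  have "(\<Sum>l\<in>{1..n}. S_tilde m i l * mu_tilde n l \<gamma>) =
      (\<Sum>l\<in>{1..n}. \<Sum>j = 1..i. real (i choose j) *
        (if m + j < i then 0 else fact (m + j - i) * real (Stirling l (m + j - i)) * real (mu n l \<gamma>)) / fact n)"
    unfolding S_tilde_def S mu_tilde_def sum_distrib_right by (intro sum.cong refl) simp
  also have "\<dots> = (\<Sum>j = 1..i. \<Sum>l\<in>{1..n}. real (i choose j) *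
        (if m + j < i then 0 else fact (m + j - i) * real (Stirling l (m + j - i)) * real (mu n l \<gamma>)) / fact n)"
    by (rule sum.swap)
  also have "\<dots> = (\<Sum>j = 1..i. real (i choose j) *
      (if m + j < i then 0 else coeff (type_poly n \<gamma>) (m + j - i)) / fact n)"
    by (intro sum.cong refl) (simp add: coeff_type_poly[OF assms] sum_distrib_left sum_divide_distrib)
  finally show ?thesis by (simp add: sum_divide_distrib)
qed

text \<open>In the binomial expansion of (1 + y)^i the term j = 0 is y^i and cancels.\<close>

lemma cycle_poly_eq_sum_monom:
  "cycle_poly i = (\<Sum>j = 1..i. monom (real (i choose j)) (i - j))"
proof -
  have "[:1, 1:] ^ i = (1 + y_poly) ^ i" by (simp add: one_pCons)
  also have "\<dots> = (\<Sum>j\<le>i. monom (real (i choose j)) (i - j))"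
    unfolding binomial_ring by (rule sum.cong) (simp_all add: monom_altdef of_nat_poly)
  also have "{..i} = insert 0 {1..i}" by auto
  also have "(\<Sum>j\<in>insert 0 {1..i}. monom (real (i choose j)) (i - j)) =
      y_poly ^ i + (\<Sum>j = 1..i. monom (real (i choose j)) (i - j))"
    by (subst sum.insert) (simp_all add: monom_altdef)
  finally show ?thesis by (simp add: cycle_poly_def)
qed

text \<open>The weights of \<open>S_tilde\<close> are thus those of multiplication by
  \<open>cycle_poly i\<close>, including the zero convention for negative indices.\<close>

lemma coeff_cycle_poly_mult:
  "coeff (cycle_poly i * f) m =
    (\<Sum>j = 1..i. real (i choose j) * (if m + j < i then 0 else coeff f (m + j - i)))"
  unfolding cycle_poly_eq_sum_monom sum_distrib_right coeff_sum coeff_monom_mult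
proof (rule sum.cong)
  fix j assume "j \<in> {1..i}"
  then have "m < i - j \<longleftrightarrow> m + j < i" "m - (i - j) = m + j - i" by auto
  then show "(if m < i - j then 0 else real (i choose j) * coeff f (m - (i - j))) =
      real (i choose j) * (if m + j < i then 0 else coeff f (m + j - i))"
    by simp
qed simp

lemma S_tilde_1: "S_tilde m 1 l = fact m * real (Stirling l m) / fact l"
  by (simp add: S_tilde_def Let_def)

theorem theorem4p11:
  fixes \<gamma> :: "nat multiset" and n i m :: nat
  assumes "is_partition \<gamma> n"
    and "size \<gamma> \<ge> 2"
    and "count \<gamma> i > 0"
    and "m \<ge> 1"
  shows "mu_tilde n m \<gamma> =
      - (\<Sum>l \<in> {m<..n}. S_tilde m 1 l * mu_tilde n l \<gamma>)
      + 1 / (real i * real (count \<gamma> i)) *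
        (\<Sum>l \<in> {0<..n - i}. S_tilde m i l * mu_tilde (n - i) l (\<gamma> - {#i#}))"
proof -
  let ?\<gamma>' = "\<gamma> - {#i#}"
  have i: "i \<in># \<gamma>" using assms(3) by simp
  then have \<gamma>: "\<gamma> = add_mset i ?\<gamma>'" by simp
  \<comment> \<open>A second part \<open>k\<close> yields \<open>1 \<le> n - i\<close>, so that
    \<open>type_poly_eq\<close> applies to the smaller size as well.\<close>
  have "?\<gamma>' \<noteq> {#}" using assms(2) \<gamma> by (metis One_nat_def Suc_1 not_less_eq_eq order_refl size_add_mset size_empty)
  then obtain k where k: "k \<in># ?\<gamma>'" by (meson multiset_nonemptyE)
  have pos: "0 < i" "0 < k"
    using assms(1) i in_diffD[OF k] by (auto simp: is_partition_def)
  have "n = i + sum_mset ?\<gamma>'"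
    using assms(1) \<gamma> by (metis is_partition_def sum_mset.add_mset)
  moreover have "k \<le> sum_mset ?\<gamma>'" using k by (metis insert_DiffM le_add1 sum_mset.add_mset)
  ultimately have n: "i < n" "1 \<le> n - i" "1 \<le> n" using pos by auto
  let ?N = "card (perms_of_type n \<gamma>)" and ?N' = "card (perms_of_type (n - i) ?\<gamma>')"
  let ?P = "y_poly * prod_mset (image_mset cycle_poly ?\<gamma>')"
  have G: "type_poly n \<gamma> = smult (real ?N) (cycle_poly i * ?P)"
    using type_poly_eq[OF n(3), of \<gamma>] by (subst (asm) (2) \<gamma>) (simp add: of_nat_poly mult.left_commute)
  have G': "type_poly (n - i) ?\<gamma>' = smult (real ?N') ?P"
    using type_poly_eq[OF n(2), of ?\<gamma>'] by (simp add: of_nat_poly)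
  have "real (i * count \<gamma> i * ?N * fact (n - i)) = real (fact n * ?N')"
    using card_perms_of_type_remove[of i n \<gamma>] pos n i by simp
  \<comment> \<open>The prefactor 1/(i a_i) of the recurrence is the ratio of the class sizes, each
    divided by its factorial.\<close>
  then have N: "real ?N / fact n = 1 / (real i * real (count \<gamma> i)) * (real ?N' / fact (n - i))"
    using pos assms(3) by (simp add: field_simps)
  have "(\<Sum>l\<in>{1..n}. S_tilde m 1 l * mu_tilde n l \<gamma>) = coeff (type_poly n \<gamma>) m / fact n"
    using sum_S_tilde_mu_tilde[OF n(3), of m 1 \<gamma>] by simp
  also have "\<dots> = real ?N / fact n * coeff (cycle_poly i * ?P) m"
    by (simp only: G coeff_smult times_divide_eq_left)
  also have "\<dots> = 1 / (real i * real (count \<gamma> i)) * (real ?N' / fact (n - i) * coeff (cycle_poly i * ?P) m)"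
    by (simp only: N mult.assoc)
  also have "real ?N' / fact (n - i) * coeff (cycle_poly i * ?P) m =
      coeff (cycle_poly i * type_poly (n - i) ?\<gamma>') m / fact (n - i)"
    by (simp only: G' mult_smult_right coeff_smult times_divide_eq_left)
  also have "\<dots> = (\<Sum>l\<in>{1..n - i}. S_tilde m i l * mu_tilde (n - i) l ?\<gamma>')"
    unfolding sum_S_tilde_mu_tilde[OF n(2)] coeff_cycle_poly_mult ..
  also have "{1..n - i} = {0<..n - i}" by auto
  finally have main: "(\<Sum>l\<in>{1..n}. S_tilde m 1 l * mu_tilde n l \<gamma>) = 1 / (real i * real (count \<gamma> i)) *
      (\<Sum>l\<in>{0<..n - i}. S_tilde m i l * mu_tilde (n - i) l ?\<gamma>')" .
  \<comment> \<open>The upper bound \<open>max m n\<close> keeps the index \<open>m\<close> in range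
    even for m > n, where \<open>mu\<close> is 0; below \<open>m\<close> the Stirling number
    vanishes.\<close>
  have "(\<Sum>l\<in>{1..n}. S_tilde m 1 l * mu_tilde n l \<gamma>) = (\<Sum>l\<in>{m..max m n}. S_tilde m 1 l * mu_tilde n l \<gamma>)"
  proof (rule sum.mono_neutral_cong)
    fix l assume l: "l \<in> {m..max m n} - {1..n}"
    have "num_cycles n p \<le> n" for p
      unfolding num_cycles_def cycles_of_def using card_image_le[of "{1..n}"] by simp
    then have "mu n l \<gamma> = 0"
      using l assms(4) unfolding mu_eq_card[OF n(3)] by (auto simp: card_eq_0_iff)
    then show "S_tilde m 1 l * mu_tilde n l \<gamma> = 0" by (simp add: mu_tilde_def)
  next
    fix l assume "l \<in> {1..n} - {m..max m n}"
    then have "l < m" by auto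
    then have "S_tilde m 1 l = 0" by (simp only: S_tilde_1) simp
    then show "S_tilde m 1 l * mu_tilde n l \<gamma> = 0" by simp
  qed auto
  also have "{m..max m n} = insert m {m<..n}" by auto
  also have "(\<Sum>l\<in>insert m {m<..n}. S_tilde m 1 l * mu_tilde n l \<gamma>) =
      mu_tilde n m \<gamma> + (\<Sum>l\<in>{m<..n}. S_tilde m 1 l * mu_tilde n l \<gamma>)"
    \<comment> \<open>The term l = m has coefficient m! S(m,m)/m! = 1.\<close>
    using S_tilde_1[of m m] by (subst sum.insert) simp_all
  finally show ?thesis using main by simp
qed

end
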